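(* Let $K\in\{K_0,K_1\}$, let $\sigma$ be a weight of $K$, and let $\pi$ be a smooth representation of $G$ which is a $G$-quotient of $\mathrm{ind}_K^G\sigma$, via a surjective $G$-map $\iota:\mathrm{ind}_K^G\sigma\to\pi$ with kernel $R(\sigma,\pi)$. If $\pi$ is finitely presented, i.e. $R(\sigma,\pi)$ is finitely generated as an $\overline{\mathbf F}_p[G]$-module, then $I^+(\sigma,\pi)\cap I^-(\sigma,\pi)$ is finite dimensional over $\overline{\mathbf F}_p$.
   Context: Group. $F$ is a non-archimedean local field of odd residue characteristic $p$, $E/F$ the unramified quadratic extension with ring of integers $\mathfrak o_E$, maximal ideal $\mathfrak p_E$, and $x\mapsto\bar x$ the non-trivial Galois conjugation; $k_F,k_E$ are the residue fields; $\varpi_E\in F$ is a uniformizer of $E$. Let $\beta=\begin{pmatrix}0&0&1\\0&1&0\\1&0&0\end{pmatrix}$ and $G=\{g\in GL_3(E): g^{T}\beta\bar g=\beta\}$ (the unramified $U(2,1)(E/F)$). Put $\alpha=\mathrm{diag}(\varpi_E^{-1},1,\varpi_E)\in G$. Let $K_0=G\cap GL_3(\mathfrak o_E)$ and $K_1=G\cap\begin{pmatrix}\mathfrak o_E&\mathfrak o_E&\mathfrak p_E^{-1}\\\mathfrak p_E&\mathfrak o_E&\mathfrak o_E\\\mathfrak p_E&\mathfrak p_E&\mathfrak o_E\end{pmatrix}$; up to conjugacy these are the maximal compact open subgroups of $G$. For $K\in\{K_0,K_1\}$ let $K^1$ be its maximal normal pro-$p$ subgroup and $\Gamma_K=K/K^1$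 (which is $U(2,1)(k_E/k_F)$ for $K_0$ and $(U(1,1)\times U(1))(k_E/k_F)$ for $K_1$). The Iwahori subgroup $I_K$ is the inverse image in $K$ of the upper triangular subgroup of $\Gamma_K$. Representations. All representations are smooth over $\overline{\mathbf F}_p$. A weight of $K$ is an irreducible smooth representation of $K$; it factors through $\Gamma_K$. $\mathrm{ind}_K^G\sigma$ is the compact induction: locally constant compactly supported $f:G\to\sigma$ with $f(kg)=\sigma(k)f(g)$ for $k\in K$, $G$ acting by right translation. For $n\ge 0$, $R_n^+(\sigma)$ (resp. $R_n^-(\sigma)$) is the space of functions in $\mathrm{ind}_K^G\sigma$ supported in $K\alpha^nI_K$ (resp. $K\alpha^{-(n+1)}I_K$). Put $I^+(\sigma)=\bigoplus_{n\ge0}R_n^+(\sigma)$, $I^-(\sigma)=\bigoplus_{n\ge0}R_n^-(\sigma)$, so that $\mathrm{ind}_K^G\sigma=I^+(\sigma)\oplus I^-(\sigma)$ as $I_K$-representations; and $I^{\pm}(\sigma,\pi)=\iota(I^{\pm}(\sigma))$. *)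

theory Defs
  imports
    "HOL-Analysis.Analysis"
    "HOL-Library.Function_Algebras"
    "HOL-Algebra.Algebraic_Closure_Type"
    "Berlekamp_Zassenhaus.Finite_Field"
begin

(* otherwise every occurrence of the vector indexing symbol is ambiguous *)
unbundle no Formal_Power_Series.fps_syntax

section \<open>Non-archimedean local fields\<close>

text \<open>
  A field that is locally compact for the metric of a non-trivial non-archimedean absolute value
  (\<open>absv\<close>, without a choice of normalisation).  Local compactness is compactness of
  the closed unit ball.
\<close>

class nonarch_local_field = field + metric_space +
  fixes absv :: "'a \<Rightarrow> real"
  assumes dist_absv: "dist x y = absv (x - y)"
    and absv_mult: "absv (x * y) = absv x * absv y"
    and absv_add_le_max: "absv (x + y) \<le> max (absv x) (absv y)"
    and absv_nontrivial: "\<exists>x. x \<noteq> 0 \<and> absv x \<noteq> 1"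
    and compact_unit_ball: "compact {x. absv x \<le> 1}"

definition integers :: "'e::nonarch_local_field set"
  where "integers = {x. absv x \<le> 1}"

definition max_ideal :: "'e::nonarch_local_field set"
  where "max_ideal = {x. absv x < 1}"

definition residue :: "'e::nonarch_local_field \<Rightarrow> 'e set"
  where "residue x = {y. y - x \<in> max_ideal}"

definition uniformizer :: "'e::nonarch_local_field \<Rightarrow> bool"
  where "uniformizer w \<longleftrightarrow> max_ideal = (\<lambda>x. w * x) ` integers"

text \<open>
  \<open>emb\<close> embeds \<open>F\<close> in \<open>E\<close>, the absolute value of \<open>E\<close> being the one that extends that of
  \<open>F\<close>; \<open>bar\<close> is the non-trivial element of the Galois group.  Residue fields are finite, so
  that the residue extension is separable and being unramified means that the maximal ideal of
  \<open>F\<close> generates that of \<open>E\<close>.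
\<close>

locale unramified_quadratic =
  fixes emb :: "'f::nonarch_local_field \<Rightarrow> 'e::nonarch_local_field"
    and bar :: "'e \<Rightarrow> 'e"
  assumes emb_add: "emb (a + b) = emb a + emb b"
    and emb_mult: "emb (a * b) = emb a * emb b"
    and emb_one: "emb 1 = 1"
    and absv_emb: "absv (emb a) = absv a"
    and degree_two: "vector_space.dim (\<lambda>a x. emb a * x) (UNIV :: 'e set) = 2"
    and unramified: "max_ideal = {emb a * x | a x. a \<in> max_ideal \<and> x \<in> integers}"
    and bar_add: "bar (x + y) = bar x + bar y"
    and bar_mult: "bar (x * y) = bar x * bar y"
    and bar_bij: "bij bar"
    and bar_emb: "bar (emb a) = emb a"
    and bar_nontrivial: "bar \<noteq> id"


section \<open>The group U(2,1) and its maximal compact subgroups\<close>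

type_synonym 'e mat3 = "'e^3^3"

definition \<beta> :: "'e::field mat3"
  where "\<beta> = vector [vector [0, 0, 1], vector [0, 1, 0], vector [1, 0, 0]]"

definition U21 :: "('e \<Rightarrow> 'e) \<Rightarrow> 'e::field mat3 set"
  where "U21 bar = {g. invertible g \<and> transpose g ** \<beta> ** map_matrix bar g = \<beta>}"

text \<open>The integral power \<open>\<alpha>\<^sup>m\<close> of \<open>\<alpha> = diag (\<omega>\<^sup>-\<^sup>1, 1, \<omega>)\<close>.\<close>

definition \<alpha>_pow :: "'e \<Rightarrow> int \<Rightarrow> 'e::field mat3"
  where "\<alpha>_pow \<omega> m =
    vector [vector [\<omega> powi (- m), 0, 0], vector [0, 1, 0], vector [0, 0, \<omega> powi m]]"

definition GL3_integers :: "'e::nonarch_local_field mat3 set"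
  where "GL3_integers = {g. (\<forall>i j. g $ i $ j \<in> integers) \<and>
    (\<exists>h. (\<forall>i j. h $ i $ j \<in> integers) \<and> g ** h = mat 1 \<and> h ** g = mat 1)}"

text \<open>The index of the two conjugacy classes of maximal compact open subgroups.\<close>

datatype vertex = V0 | V1

definition K1_lattice :: "'e \<Rightarrow> 'e::nonarch_local_field mat3 set"
  where "K1_lattice \<omega> = {g.
       g $ 1 $ 1 \<in> integers \<and> g $ 1 $ 2 \<in> integers \<and> g $ 1 $ 3 \<in> (\<lambda>x. x / \<omega>) ` integers \<and>
       g $ 2 $ 1 \<in> max_ideal \<and> g $ 2 $ 2 \<in> integers \<and> g $ 2 $ 3 \<in> integers \<and>
       g $ 3 $ 1 \<in> max_ideal \<and> g $ 3 $ 2 \<in> max_ideal \<and> g $ 3 $ 3 \<in> integers}"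

primrec max_compact :: "('e \<Rightarrow> 'e) \<Rightarrow> 'e \<Rightarrow> vertex \<Rightarrow> 'e::nonarch_local_field mat3 set"
  where
    "max_compact bar \<omega> V0 = U21 bar \<inter> GL3_integers"
  | "max_compact bar \<omega> V1 = U21 bar \<inter> K1_lattice \<omega>"

text \<open>
  The quotient map from \<open>K\<close> to \<open>\<Gamma>\<^sub>K = K / K\<^sup>1\<close>, where \<open>K\<^sup>1\<close> is the maximal normal pro-\<open>p\<close>
  subgroup, realised as a map to matrices over the residue field of
  \<open>E\<close> (whose elements are cosets of the maximal ideal).  For \<open>V0\<close> it is reduction of entries
  and its image is \<open>U(2,1)(k\<^sub>E/k\<^sub>F)\<close>.  For \<open>V1\<close>, conjugation by \<open>diag (\<omega>, 1, 1)\<close> makes all entries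
  integral, with \<open>(1,2)\<close> and \<open>(3,2)\<close> entries in the maximal ideal; the quotient is then read off
  from the corner block, which gives \<open>U(1,1)\<close>, and from the middle entry, which gives \<open>U(1)\<close>.
\<close>

fun reduction :: "'e \<Rightarrow> vertex \<Rightarrow> 'e::nonarch_local_field mat3 \<Rightarrow> ('e set)^3^3"
  where
    "reduction \<omega> V0 g = map_matrix residue g"
  | "reduction \<omega> V1 g = map_matrix residue (vector
       [vector [g $ 1 $ 1,     0,         \<omega> * g $ 1 $ 3],
        vector [0,             g $ 2 $ 2, 0],
        vector [g $ 3 $ 1 / \<omega>, 0,         g $ 3 $ 3]])"

definition upper_triangular_residue :: "('e::nonarch_local_field set)^3^3 \<Rightarrow> bool"
  where "upper_triangular_residue m \<longleftrightarrow>
    m $ 2 $ 1 = residue 0 \<and> m $ 3 $ 1 = residue 0 \<and> m $ 3 $ 2 = residue 0"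

definition iwahori :: "('e \<Rightarrow> 'e) \<Rightarrow> 'e \<Rightarrow> vertex \<Rightarrow> 'e::nonarch_local_field mat3 set"
  where "iwahori bar \<omega> v =
    {g \<in> max_compact bar \<omega> v. upper_triangular_residue (reduction \<omega> v g)}"

definition double_coset :: "'e::field mat3 set \<Rightarrow> 'e mat3 \<Rightarrow> 'e mat3 set \<Rightarrow> 'e mat3 set"
  where "double_coset K a I = {k ** a ** i | k i. k \<in> K \<and> i \<in> I}"


section \<open>Smooth representations\<close>

text \<open>An algebraic closure of the field with \<open>p = CARD('p)\<close> elements.\<close>

type_synonym 'p Fp_bar = "'p mod_ring alg_closure"

text \<open>A smooth representation of the matrix group \<open>H\<close> on the whole of the type \<open>'v\<close>.\<close>

locale smooth_rep = vector_space scl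
  for scl :: "'k::field \<Rightarrow> 'v::ab_group_add \<Rightarrow> 'v" +
  fixes H :: "'e::nonarch_local_field mat3 set"
    and \<rho> :: "'e mat3 \<Rightarrow> 'v \<Rightarrow> 'v"
  assumes linear_action: "h \<in> H \<Longrightarrow> Vector_Spaces.linear scl scl (\<rho> h)"
    and action_one: "\<rho> (mat 1) v = v"
    and action_mult: "g \<in> H \<Longrightarrow> h \<in> H \<Longrightarrow> \<rho> (g ** h) v = \<rho> g (\<rho> h v)"
    and open_stabilizer: "openin (top_of_set H) {h \<in> H. \<rho> h v = v}"

locale irreducible_smooth_rep = smooth_rep scl H \<rho>
  for scl :: "'k::field \<Rightarrow> 'v::ab_group_add \<Rightarrow> 'v"
    and H :: "'e::nonarch_local_field mat3 set"
    and \<rho> :: "'e mat3 \<Rightarrow> 'v \<Rightarrow> 'v" +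
  assumes nonzero: "\<exists>v::'v. v \<noteq> 0"
    and irreducible: "module.subspace scl S \<Longrightarrow> (\<And>h v. h \<in> H \<Longrightarrow> v \<in> S \<Longrightarrow> \<rho> h v \<in> S) \<Longrightarrow>
      S = {0} \<or> S = UNIV"

text \<open>Functions on \<open>G\<close> are represented by their extension by zero to all matrices.\<close>

definition compact_induction ::
  "'e::nonarch_local_field mat3 set \<Rightarrow> 'e mat3 set \<Rightarrow> ('e mat3 \<Rightarrow> 'w \<Rightarrow> 'w)
     \<Rightarrow> ('e mat3 \<Rightarrow> 'w::ab_group_add) set"
  where "compact_induction G K \<sigma> = {f.
    (\<forall>g. g \<notin> G \<longrightarrow> f g = 0) \<and>
    (\<forall>k\<in>K. \<forall>g\<in>G. f (k ** g) = \<sigma> k (f g)) \<and>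
    (\<forall>g\<in>G. \<exists>U. openin (top_of_set G) U \<and> g \<in> U \<and> (\<forall>h\<in>U. f h = f g)) \<and>
    (\<exists>C. compact C \<and> C \<subseteq> G \<and> (\<forall>g. g \<notin> C \<longrightarrow> f g = 0))}"

definition right_translation :: "'e::field mat3 \<Rightarrow> ('e mat3 \<Rightarrow> 'w) \<Rightarrow> ('e mat3 \<Rightarrow> 'w)"
  where "right_translation h f = (\<lambda>g. f (g ** h))"

definition fun_scale :: "('k \<Rightarrow> 'w \<Rightarrow> 'w) \<Rightarrow> 'k \<Rightarrow> ('a \<Rightarrow> 'w) \<Rightarrow> ('a \<Rightarrow> 'w)"
  where "fun_scale scl c f = (\<lambda>x. scl c (f x))"

text \<open>
  \<open>M\<close> is finitely generated as a module over the group algebra of \<open>H\<close>; the submodule generated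
  by \<open>S\<close> is the linear span of the \<open>H\<close>-translates of \<open>S\<close>.
\<close>

definition finitely_generated_over_group ::
  "('k::field \<Rightarrow> 'v::ab_group_add \<Rightarrow> 'v) \<Rightarrow> 'g set \<Rightarrow> ('g \<Rightarrow> 'v \<Rightarrow> 'v) \<Rightarrow> 'v set \<Rightarrow> bool"
  where "finitely_generated_over_group scl H \<rho> M \<longleftrightarrow>
    (\<exists>S. finite S \<and> S \<subseteq> M \<and> M = module.span scl {\<rho> h s | h s. h \<in> H \<and> s \<in> S})"

definition finite_dimensional_subspace ::
  "('k::field \<Rightarrow> 'v::ab_group_add \<Rightarrow> 'v) \<Rightarrow> 'v set \<Rightarrow> bool"
  where "finite_dimensional_subspace scl V \<longleftrightarrow> (\<exists>B. finite B \<and> V = module.span scl B)"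

text \<open>A weight \<open>\<sigma>\<close> of \<open>K\<close>, a smooth representation \<open>\<pi>\<close> of \<open>G\<close>, and a surjective \<open>G\<close>-map
  \<open>\<iota>\<close> from the compact induction of \<open>\<sigma>\<close> to \<open>\<pi>\<close>.\<close>

locale compact_induction_quotient =
  weight: irreducible_smooth_rep scaleW K \<sigma> + target: smooth_rep scaleV G \<pi>
  for scaleW :: "'k::field \<Rightarrow> 'w::ab_group_add \<Rightarrow> 'w"
    and K :: "'e::nonarch_local_field mat3 set"
    and \<sigma> :: "'e mat3 \<Rightarrow> 'w \<Rightarrow> 'w"
    and scaleV :: "'k \<Rightarrow> 'v::ab_group_add \<Rightarrow> 'v"
    and G :: "'e mat3 set"
    and \<pi> :: "'e mat3 \<Rightarrow> 'v \<Rightarrow> 'v" +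
  fixes \<iota> :: "('e mat3 \<Rightarrow> 'w) \<Rightarrow> 'v"
  assumes map_add: "f \<in> compact_induction G K \<sigma> \<Longrightarrow> f' \<in> compact_induction G K \<sigma> \<Longrightarrow>
      \<iota> (f + f') = \<iota> f + \<iota> f'"
    and map_scale: "f \<in> compact_induction G K \<sigma> \<Longrightarrow> \<iota> (fun_scale scaleW c f) = scaleV c (\<iota> f)"
    and map_equivariant: "g \<in> G \<Longrightarrow> f \<in> compact_induction G K \<sigma> \<Longrightarrow>
      \<iota> (right_translation g f) = \<pi> g (\<iota> f)"
    and map_surj: "\<iota> ` compact_induction G K \<sigma> = UNIV"

definition induction_kernel ::
  "'e::nonarch_local_field mat3 set \<Rightarrow> 'e mat3 set \<Rightarrow> ('e mat3 \<Rightarrow> 'w::ab_group_add \<Rightarrow> 'w)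
     \<Rightarrow> (('e mat3 \<Rightarrow> 'w) \<Rightarrow> 'v::zero) \<Rightarrow> ('e mat3 \<Rightarrow> 'w) set"
  where "induction_kernel G K \<sigma> \<iota> = {f \<in> compact_induction G K \<sigma>. \<iota> f = 0}"


section \<open>The two halves of the compact induction\<close>

definition supported_part ::
  "('e::nonarch_local_field \<Rightarrow> 'e) \<Rightarrow> 'e \<Rightarrow> vertex \<Rightarrow> ('e mat3 \<Rightarrow> 'w::ab_group_add \<Rightarrow> 'w)
     \<Rightarrow> int \<Rightarrow> ('e mat3 \<Rightarrow> 'w) set"
  where "supported_part bar \<omega> v \<sigma> m =
    {f \<in> compact_induction (U21 bar) (max_compact bar \<omega> v) \<sigma>.
      \<forall>g. f g \<noteq> 0 \<longrightarrow>
        g \<in> double_coset (max_compact bar \<omega> v) (\<alpha>_pow \<omega> m) (iwahori bar \<omega> v)}"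

definition R_plus ::
  "('e::nonarch_local_field \<Rightarrow> 'e) \<Rightarrow> 'e \<Rightarrow> vertex \<Rightarrow> ('e mat3 \<Rightarrow> 'w::ab_group_add \<Rightarrow> 'w)
     \<Rightarrow> nat \<Rightarrow> ('e mat3 \<Rightarrow> 'w) set"
  where "R_plus bar \<omega> v \<sigma> n = supported_part bar \<omega> v \<sigma> (int n)"

definition R_minus ::
  "('e::nonarch_local_field \<Rightarrow> 'e) \<Rightarrow> 'e \<Rightarrow> vertex \<Rightarrow> ('e mat3 \<Rightarrow> 'w::ab_group_add \<Rightarrow> 'w)
     \<Rightarrow> nat \<Rightarrow> ('e mat3 \<Rightarrow> 'w) set"
  where "R_minus bar \<omega> v \<sigma> n = supported_part bar \<omega> v \<sigma> (- (int n + 1))"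

text \<open>
  The double cosets are disjoint for distinct powers of \<open>\<alpha>\<close>, so these sums of subspaces are direct.
\<close>

definition I_plus ::
  "('e::nonarch_local_field \<Rightarrow> 'e) \<Rightarrow> 'e \<Rightarrow> vertex \<Rightarrow> ('k::field \<Rightarrow> 'w::ab_group_add \<Rightarrow> 'w)
     \<Rightarrow> ('e mat3 \<Rightarrow> 'w \<Rightarrow> 'w) \<Rightarrow> ('e mat3 \<Rightarrow> 'w) set"
  where "I_plus bar \<omega> v scl \<sigma> = module.span (fun_scale scl) (\<Union>n. R_plus bar \<omega> v \<sigma> n)"

definition I_minus ::
  "('e::nonarch_local_field \<Rightarrow> 'e) \<Rightarrow> 'e \<Rightarrow> vertex \<Rightarrow> ('k::field \<Rightarrow> 'w::ab_group_add \<Rightarrow> 'w)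
     \<Rightarrow> ('e mat3 \<Rightarrow> 'w \<Rightarrow> 'w) \<Rightarrow> ('e mat3 \<Rightarrow> 'w) set"
  where "I_minus bar \<omega> v scl \<sigma> = module.span (fun_scale scl) (\<Union>n. R_minus bar \<omega> v \<sigma> n)"

end

theory Submission
  imports Defs
begin

text \<open>
  The side of \<open>g\<close> is read off from a \<open>K\<close>-invariant norm of its first and last columns: \<open>I\<^sup>+\<close> lives
  where the last column is not much larger than the first, \<open>I\<^sup>-\<close> on the complement, and both
  regions are open and left \<open>K\<close>-invariant.  If \<open>\<iota> f = \<iota> f'\<close> with \<open>f\<close> in \<open>I\<^sup>+\<close> and \<open>f'\<close> in \<open>I\<^sup>-\<close>, then
  \<open>f\<close> is the restriction of the kernel element \<open>f - f'\<close> to the first region.  Hence the intersection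
  is contained in the span of the images of the restrictions of all translates of the generators
  of the kernel.  A translate supported on one side contributes \<open>0\<close>.  Only finitely many
  translates are supported on both sides: the support of \<open>s\<close> translated by \<open>h\<close> is \<open>C h\<^sup>-\<^sup>1\<close> with \<open>C\<close>
  compact, and a matrix \<open>x = h\<^sup>-\<^sup>1\<close> with a large entry is close to a matrix of rank one, whose row
  alone decides the side of \<open>c x\<close> for all \<open>c\<close> in \<open>C\<close>; so \<open>h\<close> is bounded, and \<open>s\<close> is uniformly
  locally constant.
\<close>


section \<open>Absolute values\<close>

lemma absv_eq_dist: "absv x = dist x 0" for x :: "'a::nonarch_local_field"
  by (simp add: dist_absv)

lemma absv_nonneg [simp]: "0 \<le> absv x" for x :: "'a::nonarch_local_field"
  by (simp add: absv_eq_dist)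

lemma absv_eq_0_iff [simp]: "absv x = 0 \<longleftrightarrow> x = 0" for x :: "'a::nonarch_local_field"
  by (simp add: absv_eq_dist)

lemma absv_0 [simp]: "absv (0 :: 'a::nonarch_local_field) = 0"
  by simp

lemma absv_pos_iff [simp]: "0 < absv x \<longleftrightarrow> x \<noteq> 0" for x :: "'a::nonarch_local_field"
  using absv_eq_0_iff[of x] absv_nonneg[of x] by linarith

lemma absv_1 [simp]: "absv (1 :: 'a::nonarch_local_field) = 1"
  proof -
  have "absv (1 :: 'a) * absv (1 :: 'a) = absv (1 :: 'a) * 1"
    by (simp flip: absv_mult)
  then show ?thesis
    by (subst (asm) mult_cancel_left) simp
qed

lemma absv_diff_commute: "absv (x - y) = absv (y - x)" for x :: "'a::nonarch_local_field"
  by (metis dist_absv dist_commute)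

lemma absv_minus [simp]: "absv (- x) = absv x" for x :: "'a::nonarch_local_field"
  using absv_diff_commute[of 0 x] by simp

lemma absv_power: "absv (x ^ n) = absv x ^ n" for x :: "'a::nonarch_local_field"
  by (induction n) (auto simp: absv_mult)

lemma absv_inverse: "absv (inverse x) = inverse (absv x)" for x :: "'a::nonarch_local_field"
proof (cases "x = 0")
  case False
  then have "absv x * absv (inverse x) = 1"
    by (metis absv_1 absv_mult right_inverse)
  then show ?thesis
    by (metis inverse_unique)
qed simp

lemma absv_divide: "absv (x / y) = absv x / absv y" for x :: "'a::nonarch_local_field"
  by (simp add: divide_inverse absv_mult absv_inverse)

lemma absv_power_int: "absv (x powi n) = absv x powi n" for x :: "'a::nonarch_local_field"
  by (simp add: power_int_def absv_power absv_inverse)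

lemma absv_add_le: "absv x \<le> r \<Longrightarrow> absv y \<le> r \<Longrightarrow> absv (x + y) \<le> r"
  for x :: "'a::nonarch_local_field"
  using absv_add_le_max[of x y] by linarith

lemma absv_add_less: "absv x < r \<Longrightarrow> absv y < r \<Longrightarrow> absv (x + y) < r"
  for x :: "'a::nonarch_local_field"
  using absv_add_le_max[of x y] by linarith

lemma absv_diff_le: "absv x \<le> r \<Longrightarrow> absv y \<le> r \<Longrightarrow> absv (x - y) \<le> r"
  for x :: "'a::nonarch_local_field"
  using absv_add_le[of x r "- y"] by simp

text \<open>Some power \<open>c\<close> of an element of absolute value above 1 has
  \<open>absv c > r\<close>. Multiplication by \<open>c\<close> maps the compact unit ball onto a
  compact set that covers the closed ball of radius \<open>r\<close>.\<close>

lemma compact_absv_ball: "compact {x :: 'a::nonarch_local_field. absv x \<le> r}"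
proof -
  obtain z :: 'a where z: "z \<noteq> 0" "absv z \<noteq> 1"
    using absv_nontrivial by blast
  obtain y :: 'a where y: "1 < absv y"
  proof (cases "absv z < 1")
    case True
    then show thesis
      using z that[of "inverse z"] by (simp add: absv_inverse one_less_inverse_iff)
  next
    case False
    then show thesis
      using z by (intro that[of z]) simp
  qed
  obtain n where n: "r < absv y ^ n"
    using real_arch_pow[OF y] by blast
  define c where "c = y ^ n"
  have c: "c \<noteq> 0" "r < absv c"
    using y n by (auto simp: c_def absv_power)
  have "continuous_on {x. absv x \<le> 1} ((*) c)"
  proof -
    have "dist (c * x) (c * x') \<le> absv c * dist x x'" for x x'
      by (simp add: dist_absv absv_mult flip: right_diff_distrib)
    then show ?thesis
      by (intro lipschitz_on_continuous_on[of "absv c"]) (auto simp: lipschitz_on_def)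
  qed
  then have "compact ((*) c ` {x. absv x \<le> 1})"
    using compact_unit_ball compact_continuous_image by blast
  moreover have "closed {x :: 'a. absv x \<le> r}"
  proof -
    have "{x :: 'a. absv x \<le> r} = cball 0 r"
      by (auto simp: absv_eq_dist dist_commute)
    then show ?thesis
      by simp
  qed
  moreover have "{x. absv x \<le> r} \<subseteq> (*) c ` {x. absv x \<le> 1}"
  proof
    fix x :: 'a assume "x \<in> {x. absv x \<le> r}"
    then have "absv (x / c) \<le> 1"
      using c by (simp add: absv_divide divide_le_eq)
    then show "x \<in> (*) c ` {x. absv x \<le> 1}"
      using c by (intro image_eqI[of _ _ "x / c"]) auto
  qed
  ultimately show ?thesis
    by (metis closed_Int_compact inf.absorb_iff1)
qed

lemma finite_absv_net:
  assumes "0 < e"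
  obtains S :: "'a::nonarch_local_field set"
  where "finite S" "\<And>x. absv x \<le> r \<Longrightarrow> \<exists>y\<in>S. absv (x - y) < e"
proof -
  obtain S :: "'a set" where S: "finite S" "{x. absv x \<le> r} \<subseteq> (\<Union>x\<in>S. ball x e)"
    using compact_absv_ball[of r] assms unfolding compact_eq_totally_bounded by blast
  show thesis
    using S by (intro that[of S]) (force simp: dist_absv absv_diff_commute subset_iff)+
qed

text \<open>Non-triviality of the absolute value yields a nonzero element of
  \<open>max_ideal\<close>, which excludes \<open>w = 0\<close>.\<close>

lemma uniformizer_absv:
  fixes w :: "'a::nonarch_local_field"
  assumes "uniformizer w"
  shows "w \<noteq> 0" "absv w < 1"
proof -
  have m: "max_ideal = (\<lambda>x. w * x) ` integers"
    using assms by (simp add: uniformizer_def)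
  obtain z :: 'a where z: "z \<noteq> 0" "absv z \<noteq> 1"
    using absv_nontrivial by blast
  have "\<exists>y :: 'a. y \<noteq> 0 \<and> absv y < 1"
  proof (cases "absv z < 1")
    case False
    then have "absv (inverse z) < 1"
      using z by (simp add: absv_inverse inverse_less_1_iff)
    then show ?thesis
      using z by (intro exI[of _ "inverse z"]) auto
  qed (use z in auto)
  then show "w \<noteq> 0"
    using m by (auto simp: max_ideal_def)
  have "w * 1 \<in> max_ideal"
    unfolding m by (intro imageI) (simp add: integers_def)
  then show "absv w < 1"
    by (simp add: max_ideal_def)
qed

section \<open>Galois conjugation is isometric\<close>

context unramified_quadratic
begin

lemma vector_space_emb: "vector_space (\<lambda>a x. emb a * x)"
  by unfold_locales (auto simp: emb_add emb_mult emb_one algebra_simps)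

lemma quadratic_generator:
  obtains d where "d \<notin> range emb" "\<And>x. \<exists>a b. x = emb a + emb b * d"
proof -
  interpret vector_space "\<lambda>a x. emb a * x"
    by (rule vector_space_emb)
  have ind: "independent {1}"
    by (simp add: dependent_single)
  define B where "B = extend_basis {1}"
  have B: "{1} \<subseteq> B" "independent B" "span B = UNIV"
    using extend_basis_superset[OF ind] independent_extend_basis[OF ind]
      span_extend_basis[OF ind] by (auto simp: B_def)
  then have "card B = 2"
    using dim_eq_card[of B UNIV] degree_two by simp
  then obtain d where d: "B = {1, d}" "d \<noteq> 1"
    using B(1) by (auto simp: card_2_iff)
  have "d \<notin> span {1}"
    using B(2) d independent_insert[of d "{1}"] by (auto simp: insert_commute)
  then have 1: "d \<notin> range emb"
    by (auto simp: span_singleton)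
  have 2: "\<exists>a b. x = emb a + emb b * d" for x
  proof -
    have "x \<in> span {d, 1}"
      using B(3) d by (simp add: insert_commute)
    then obtain b where "x - emb b * d \<in> span {1}"
      using span_breakdown_eq by blast
    then obtain a where "x - emb b * d = emb a"
      by (auto simp: span_singleton)
    then show ?thesis
      by (metis diff_add_cancel)
  qed
  show thesis
    using that 1 2 by blast
qed

lemma emb_diff: "emb (a - b) = emb a - emb b"
  using emb_add[of "a - b" b] by (simp add: eq_diff_eq)

text \<open>By the ultrametric inequality, an \<open>emb a\<close> nearer to \<open>d\<close> than
  \<open>absv d\<close> lies in the image of the ball of radius \<open>absv d\<close>. That image is
  compact, hence closed, and misses \<open>d\<close>.\<close>

lemma distance_to_emb_pos:
  assumes "d \<notin> range emb"
  obtains r where "0 < r" "\<And>a. r \<le> absv (emb a - d)"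
proof -
  define T where "T = emb ` {a. absv a \<le> absv d}"
  have "continuous_on {a. absv a \<le> absv d} emb"
    unfolding continuous_on_iff by (auto simp: dist_absv absv_emb simp flip: emb_diff)
  then have "compact T"
    unfolding T_def by (intro compact_continuous_image compact_absv_ball)
  then have "open (- T)"
    using compact_imp_closed by blast
  moreover have "d \<in> - T"
    using assms by (auto simp: T_def)
  ultimately obtain e where e: "0 < e" "ball d e \<subseteq> - T"
    using open_contains_ball by meson
  have "emb 0 = 0"
    using emb_diff[of 0 0] by simp
  then have "d \<noteq> 0"
    using assms by (metis rangeI)
  show thesis
  proof (rule that)
    show "0 < min e (absv d)"
      using e \<open>d \<noteq> 0\<close> by simp
    fix a
    show "min e (absv d) \<le> absv (emb a - d)"
    proof (rule ccontr)
      assume *: "\<not> ?thesis"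
      then have "absv (emb a - d + d) \<le> absv d"
        by (intro absv_add_le) auto
      then have "emb a \<in> T"
        by (simp add: T_def absv_emb)
      moreover have "emb a \<in> ball d e"
        using * by (auto simp: dist_absv absv_diff_commute)
      ultimately show False
        using e by auto
    qed
  qed
qed

lemma bar_diff: "bar (x - y) = bar x - bar y"
  using bar_add[of "x - y" y] by (simp add: eq_diff_eq)

lemma bar_0 [simp]: "bar 0 = 0"
  using bar_diff[of 0 0] by simp

lemma bar_1 [simp]: "bar 1 = 1"
  using bar_emb[of 1] by (simp add: emb_one)

text \<open>All norms on the plane \<open>E\<close> over \<open>F\<close> are equivalent, so an automorphism is bounded by a
  constant \<open>C\<close>; applied to \<open>x ^ n\<close> this removes the constant.\<close>

lemma absv_automorphism_le:
  assumes add: "\<And>x y. \<tau> (x + y) = \<tau> x + \<tau> y" and mult: "\<And>x y. \<tau> (x * y) = \<tau> x * \<tau> y"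
    and emb_fixed: "\<And>a. \<tau> (emb a) = emb a"
  shows "absv (\<tau> x) \<le> absv x"
proof -
  obtain d where d: "d \<notin> range emb" "\<And>x. \<exists>a b. x = emb a + emb b * d"
    using quadratic_generator by blast
  obtain r where r: "0 < r" "\<And>a. r \<le> absv (emb a - d)"
    by (rule distance_to_emb_pos[OF d(1)]) blast
  \<comment> \<open>The three terms of the maximum control \<open>y\<close> itself, its component
    along \<open>d\<close>, and the image of that component under \<open>\<tau>\<close>.\<close>
  define C where "C = max 1 (max (absv d) (absv (\<tau> d)) / r)"
  have C: "1 \<le> C" "absv d / r \<le> C" "absv (\<tau> d) / r \<le> C"
    using r by (auto simp: C_def divide_right_mono intro: max.coboundedI2)
  have bound: "absv (\<tau> y) \<le> C * absv y" for y
  proof -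
    obtain a b where y: "y = emb a + emb b * d"
      using d(2) by blast
    \<comment> \<open>Factoring \<open>- emb b\<close> out of \<open>y\<close> leaves the difference
      of a point of \<open>range emb\<close> and \<open>d\<close>, of absolute value at least
      \<open>r\<close>.\<close>
    have b: "absv (emb b) * r \<le> absv y"
    proof (cases "b = 0")
      case False
      then have nz: "emb b \<noteq> 0"
        by (metis absv_emb absv_eq_0_iff)
      have "emb (- a / b) * emb b = - emb a"
        using False emb_mult[of "- a / b" b] emb_diff[of 0 a] emb_diff[of 0 0] by simp
      then have "y = - (emb b * (emb (- a / b) - d))"
        by (simp add: y algebra_simps)
      then have "absv y = absv (emb b) * absv (emb (- a / b) - d)"
        by (simp add: absv_mult)
      then show ?thesis
        using r(2) by (simp add: mult_left_mono)
    qed (simp add: absv_emb)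
    have bd: "absv (emb b * z) \<le> C * absv y" if "absv z / r \<le> C" for z
    proof -
      have "absv (emb b) * absv z = (absv (emb b) * r) * (absv z / r)"
        using r by simp
      also have "\<dots> \<le> absv y * C"
        using b that C r by (intro mult_mono) auto
      finally show ?thesis
        by (simp add: absv_mult mult.commute)
    qed
    have "absv y \<le> C * absv y"
      using C mult_right_mono[of 1 C "absv y"] by simp
    then have "absv (y - emb b * d) \<le> C * absv y"
      by (intro absv_diff_le bd C)
    then have a: "absv (emb a) \<le> C * absv y"
      by (simp add: y)
    have "\<tau> y = emb a + emb b * \<tau> d"
      by (simp add: y add mult emb_fixed)
    then show ?thesis
      by (metis a absv_add_le bd C(3))
  qed
  have pow: "\<tau> (x ^ n) = \<tau> x ^ n" for n
    using emb_fixed[of 1] by (induction n) (auto simp: mult emb_one)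
  show ?thesis
  proof (rule ccontr)
    assume less: "\<not> ?thesis"
    show False
    proof (cases "x = 0")
      case True
      then show False
        using less bound[of x] by simp
    next
      case False
      then have "1 < absv (\<tau> x) / absv x"
        using less by simp
      then obtain n where "C < (absv (\<tau> x) / absv x) ^ n"
        using real_arch_pow by blast
      then have "C * absv (x ^ n) < absv (\<tau> (x ^ n))"
        using False by (simp add: power_divide pow absv_power pos_less_divide_eq)
      then show False
        using bound[of "x ^ n"] by simp
    qed
  qed
qed

lemma absv_bar [simp]: "absv (bar x) = absv x"
proof (rule antisym)
  show "absv (bar x) \<le> absv x"
    by (rule absv_automorphism_le) (auto simp: bar_add bar_mult bar_emb)
  have inj: "inj bar" and surj: "surj bar"
    using bar_bij by (auto simp: bij_def)
  \<comment> \<open>The reverse inequality is the same bound for the inverse automorphism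
    \<open>c\<close>.\<close>
  define c where "c = inv_into UNIV bar"
  have i: "bar (c y) = y" for y
    using surj by (simp add: c_def surj_f_inv_f)
  have c_eq: "c y = z" if "bar z = y" for y z
    using inj that by (auto simp: c_def)
  have "absv (c (bar x)) \<le> absv (bar x)"
    by (rule absv_automorphism_le) (auto intro!: c_eq simp: bar_add bar_mult bar_emb i)
  then show "absv x \<le> absv (bar x)"
    by (simp add: c_eq)
qed

end

section \<open>The unitary group\<close>

text \<open>The permutation given by the matrix \<open>\<beta>\<close>.\<close>

definition opp :: "3 \<Rightarrow> 3"
  where "opp i = (if i = 1 then 3 else if i = 3 then 1 else 2)"

lemma opp_simps [simp]: "opp 1 = 3" "opp 2 = 2" "opp 3 = 1"
  by (simp_all add: opp_def)

lemma opp_opp [simp]: "opp (opp i) = i"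
  using exhaust_3[of i] by auto

lemma matrix_mult_3_entry:
  "(A ** B) $ i $ j = A $ i $ 1 * B $ 1 $ j + A $ i $ 2 * B $ 2 $ j + A $ i $ 3 * B $ 3 $ j"
  for A :: "'a::semiring_1^3^'n" and B :: "'a^'m^3"
  by (simp add: matrix_matrix_mult_def sum_3)

lemma matrix_vector_mult_3_entry:
  "(A *v y) $ i = A $ i $ 1 * y $ 1 + A $ i $ 2 * y $ 2 + A $ i $ 3 * y $ 3"
  for A :: "'a::semiring_1^3^'n"
  by (simp add: matrix_vector_mult_def sum_3)

lemma column_matrix_mult: "column j (A ** B) = A *v column j B"
  by (simp add: column_def matrix_vector_mult_def matrix_matrix_mult_def)

lemma matrix_inv_mult:
  fixes g :: "'a::semiring_1^'n^'n"
  assumes "invertible g"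
  shows "g ** matrix_inv g = mat 1" "matrix_inv g ** g = mat 1"
  using someI_ex[OF assms[unfolded invertible_def]] by (simp_all add: matrix_inv_def)

lemma \<beta>_mult_entry: "(\<beta> ** A) $ i $ j = A $ opp i $ j" for A :: "'a::field mat3"
  using exhaust_3[of i] by (auto simp: \<beta>_def matrix_mult_3_entry)

lemma mult_\<beta>_entry: "(A ** \<beta>) $ i $ j = A $ i $ opp j" for A :: "'a::field mat3"
  using exhaust_3[of j] by (auto simp: \<beta>_def matrix_mult_3_entry)

text \<open>Taking the rows and columns of a minor in cyclic order builds the sign of the cofactor
  into the order of the factors.\<close>

definition cyc :: "3 \<Rightarrow> 3"
  where "cyc i = (if i = 1 then 2 else if i = 2 then 3 else 1)"

lemma cyc_simps [simp]: "cyc 1 = 2" "cyc 2 = 3" "cyc 3 = 1"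
  by (simp_all add: cyc_def)

text \<open>Two distinct indices are the cyclic successors of the third one, in one of the two
  orders. Hence every proper minor is a cofactor up to sign.\<close>

lemma distinct_cyc_cases:
  assumes "i \<noteq> a"
  obtains l where "i = cyc l" "a = cyc (cyc l)" | l where "a = cyc l" "i = cyc (cyc l)"
proof -
  have "(i = cyc (cyc a) \<and> a = cyc (cyc (cyc a))) \<or> (a = cyc (cyc i) \<and> i = cyc (cyc (cyc i)))"
    using assms exhaust_3[of i] exhaust_3[of a] by auto
  then show thesis
    using that by blast
qed

text \<open>The left sides form the adjugate matrix, whose product with \<open>g\<close> is the
  scalar matrix \<open>det g\<close>; multiplying by the inverse of \<open>g\<close> gives the
  claim.\<close>

lemma cofactor_eq:
  fixes g :: "'a::field mat3"
  assumes "invertible g"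
  shows "g $ cyc l $ cyc k * g $ cyc (cyc l) $ cyc (cyc k)
      - g $ cyc l $ cyc (cyc k) * g $ cyc (cyc l) $ cyc k
    = det g * matrix_inv g $ k $ l"
proof -
  define adj :: "'a mat3" where "adj = (\<chi> k l. g $ cyc l $ cyc k * g $ cyc (cyc l) $ cyc (cyc k)
      - g $ cyc l $ cyc (cyc k) * g $ cyc (cyc l) $ cyc k)"
  have "adj ** g = mat (det g)"
    by (simp add: vec_eq_iff forall_3 matrix_mult_3_entry adj_def det_3 mat_def algebra_simps)
  then have "mat (det g) ** matrix_inv g = adj"
    using matrix_inv_mult[OF assms] by (metis matrix_mul_assoc matrix_mul_rid)
  then have "adj $ k $ l = (mat (det g) ** matrix_inv g) $ k $ l"
    by simp
  also have "\<dots> = det g * matrix_inv g $ k $ l"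
    using exhaust_3[of k] by (auto simp: mat_def matrix_mult_3_entry)
  finally show ?thesis
    by (simp add: adj_def)
qed

section \<open>Inverses, Hermitian forms, determinants and minors of unitary matrices\<close>

context unramified_quadratic
begin

lemma map_matrix_bar_mult:
  "map_matrix bar (A ** B) = map_matrix bar A ** map_matrix bar B" for A B :: "'e mat3"
  by (simp add: vec_eq_iff matrix_mult_3_entry bar_add bar_mult)

lemma map_matrix_bar_one: "map_matrix bar (mat 1) = mat 1"
  by (simp add: vec_eq_iff mat_def)

lemma U21_invertible: "g \<in> U21 bar \<Longrightarrow> invertible g"
  by (simp add: U21_def)

lemma U21_column_form:
  assumes "g \<in> U21 bar"
  shows "g $ 1 $ i * bar (g $ 3 $ j) + g $ 2 $ i * bar (g $ 2 $ j) + g $ 3 $ i * bar (g $ 1 $ j)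
    = \<beta> $ i $ j"
proof -
  have "(transpose g ** \<beta> ** map_matrix bar g) $ i $ j = \<beta> $ i $ j"
    using assms by (simp add: U21_def)
  then show ?thesis
    by (simp add: matrix_mult_3_entry[of "transpose g ** \<beta>"] mult_\<beta>_entry)
      (simp add: transpose_def algebra_simps)
qed

lemma U21_mult:
  assumes "g \<in> U21 bar" "h \<in> U21 bar"
  shows "g ** h \<in> U21 bar"
proof -
  have "transpose (g ** h) ** \<beta> ** map_matrix bar (g ** h)
      = transpose h ** (transpose g ** \<beta> ** map_matrix bar g) ** map_matrix bar h"
    by (simp add: map_matrix_bar_mult matrix_transpose_mul matrix_mul_assoc)
  also have "\<dots> = \<beta>"
    using assms by (simp add: U21_def)
  finally show ?thesis
    using assms by (simp add: U21_def invertible_mult)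
qed

lemma U21_matrix_inv:
  assumes "g \<in> U21 bar"
  shows "matrix_inv g \<in> U21 bar"
proof -
  define h where "h = matrix_inv g"
  have gh: "g ** h = mat 1" "h ** g = mat 1"
    using matrix_inv_mult U21_invertible[OF assms] by (auto simp: h_def)
  have "\<beta> = transpose (g ** h) ** \<beta> ** map_matrix bar (g ** h)"
    by (simp add: gh map_matrix_bar_one transpose_mat)
  also have "\<dots> = transpose h ** (transpose g ** \<beta> ** map_matrix bar g) ** map_matrix bar h"
    by (simp add: map_matrix_bar_mult matrix_transpose_mul matrix_mul_assoc)
  also have "\<dots> = transpose h ** \<beta> ** map_matrix bar h"
    using assms by (simp add: U21_def)
  finally show ?thesis
    using gh by (auto simp: U21_def invertible_def simp flip: h_def)
qed

text \<open>Cancelling \<open>transpose g\<close> from the defining equation expresses the inverse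
  by conjugated entries, reflected in the antidiagonal. As \<open>bar\<close> is isometric, a common
  bound on all entries passes to the inverse.\<close>

lemma U21_inv_entry:
  assumes "g \<in> U21 bar"
  shows "matrix_inv g $ i $ j = bar (g $ opp j $ opp i)"
proof -
  define h where "h = matrix_inv g"
  have "g ** h = mat 1"
    using matrix_inv_mult U21_invertible[OF assms] by (auto simp: h_def)
  then have "transpose h ** transpose g = mat 1"
    by (metis matrix_transpose_mul transpose_mat)
  then have "\<beta> ** map_matrix bar g = transpose h ** (transpose g ** \<beta> ** map_matrix bar g)"
    by (simp add: matrix_mul_assoc)
  also have "\<dots> = transpose h ** \<beta>"
    using assms by (simp add: U21_def)
  finally have "(\<beta> ** map_matrix bar g) $ j $ opp i = (transpose h ** \<beta>) $ j $ opp i"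
    by simp
  then show ?thesis
    by (simp add: \<beta>_mult_entry mult_\<beta>_entry transpose_def h_def)
qed

lemma U21_row_form:
  assumes "g \<in> U21 bar"
  shows "g $ i $ 1 * bar (g $ j $ 3) + g $ i $ 2 * bar (g $ j $ 2) + g $ i $ 3 * bar (g $ j $ 1)
    = (if j = opp i then 1 else 0)"
proof -
  have "(g ** matrix_inv g) $ i $ opp j = (mat 1 :: 'e mat3) $ i $ opp j"
    by (simp add: matrix_inv_mult U21_invertible[OF assms])
  then show ?thesis
    using exhaust_3[of i] exhaust_3[of j]
    by (auto simp: matrix_mult_3_entry U21_inv_entry[OF assms] mat_def)
qed

text \<open>Determinants of the defining equation give \<open>det g * bar (det g) = 1\<close>, and
  \<open>bar\<close> is isometric.\<close>

lemma U21_absv_det: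
  assumes "g \<in> U21 bar"
  shows "absv (det g) = 1"
proof -
  have "det (map_matrix bar g) = bar (det g)"
    by (simp add: det_3 bar_add bar_diff bar_mult)
  moreover have "det (transpose g ** \<beta> ** map_matrix bar g) = det (\<beta> :: 'e mat3)"
    using assms by (simp add: U21_def)
  moreover have "det (\<beta> :: 'e mat3) = - 1"
    by (simp add: det_3 \<beta>_def)
  ultimately have "det g * bar (det g) = 1"
    by (simp add: det_mul)
  then have "absv (det g) * absv (det g) = 1"
    by (metis absv_1 absv_bar absv_mult)
  then show ?thesis
    by (metis absv_nonneg abs_of_nonneg real_sqrt_abs2 real_sqrt_one)
qed

text \<open>A proper minor is, up to sign, \<open>det g\<close> times an entry of the inverse, and
  so has the absolute value of an entry of \<open>g\<close>. This is special to the unitary group: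
  for a general matrix minors grow quadratically.\<close>

lemma U21_absv_minor_le:
  assumes g: "g \<in> U21 bar" and r: "\<And>i j. absv (g $ i $ j) \<le> r"
  shows "absv (g $ i $ j * g $ a $ b - g $ i $ b * g $ a $ j) \<le> r"
proof -
  define D where "D i j a b = absv (g $ i $ j * g $ a $ b - g $ i $ b * g $ a $ j)" for i j a b
  have "D (cyc l) (cyc k) (cyc (cyc l)) (cyc (cyc k)) \<le> r" for k l
    unfolding D_def cofactor_eq[OF U21_invertible[OF g]]
    by (simp add: absv_mult U21_absv_det[OF g] U21_inv_entry[OF g] r)
  \<comment> \<open>Exchanging rows or columns only changes the sign of the minor, which brings any
    two distinct rows and columns into cyclic order.\<close>
  moreover have "D i j a b = D i b a j" "D i j a b = D a j i b" "D i j a b = D a b i j" for i j a b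
    unfolding D_def by (subst absv_diff_commute, simp add: mult.commute)+
  ultimately have "D i j a b \<le> r" if "i \<noteq> a" "j \<noteq> b"
    using that by (elim distinct_cyc_cases) metis+
  moreover have "D i j a b \<le> r" if "i = a \<or> j = b"
    using that order_trans[OF absv_nonneg r] by (auto simp: D_def)
  ultimately show ?thesis
    by (auto simp: D_def)
qed

end

section \<open>A lattice norm on columns\<close>

text \<open>The unit ball is the lattice of integral columns for \<open>t = 1\<close>; for
  \<open>t = 1 / absv \<omega>\<close> the third entry must moreover lie in the maximal ideal. These
  lattices are stable under the maximal compact subgroups for \<open>V0\<close> and
  \<open>V1\<close>.\<close>

definition wnorm :: "real \<Rightarrow> 'e::nonarch_local_field^3 \<Rightarrow> real"
  where "wnorm t y = max (max (absv (y $ 1)) (absv (y $ 2))) (t * absv (y $ 3))"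

lemma wnorm_le_iff:
  "wnorm t y \<le> r \<longleftrightarrow> absv (y $ 1) \<le> r \<and> absv (y $ 2) \<le> r \<and> t * absv (y $ 3) \<le> r"
  by (auto simp: wnorm_def)

lemma wnorm_minus [simp]: "wnorm t (- y) = wnorm t y"
  by (simp add: wnorm_def)

lemma wnorm_scale: "wnorm t (c *s y) = absv c * wnorm t y"
  by (simp add: wnorm_def absv_mult max_mult_distrib_left mult.left_commute)

lemma wnorm_add_le:
  assumes "0 \<le> t" "wnorm t x \<le> r" "wnorm t y \<le> r"
  shows "wnorm t (x + y) \<le> r"
proof -
  have "t * absv (x $ 3 + y $ 3) \<le> t * max (absv (x $ 3)) (absv (y $ 3))"
    using assms(1) absv_add_le_max by (rule mult_left_mono[rotated])
  then show ?thesis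
    using assms by (auto simp: wnorm_le_iff max_def intro: absv_add_le split: if_splits)
qed

text \<open>A strictly smaller summand cannot change an ultrametric norm: otherwise
  \<open>y\<close>, as the difference of \<open>y + d\<close> and \<open>d\<close>, would be smaller
  than itself.\<close>

lemma wnorm_add_eq:
  assumes "0 \<le> t" "wnorm t d < wnorm t y"
  shows "wnorm t (y + d) = wnorm t y"
proof (rule antisym)
  show "wnorm t (y + d) \<le> wnorm t y"
    using assms by (intro wnorm_add_le) auto
  show "wnorm t y \<le> wnorm t (y + d)"
  proof (rule ccontr)
    assume "\<not> ?thesis"
    moreover have "wnorm t ((y + d) + (- d)) \<le> max (wnorm t (y + d)) (wnorm t d)"
      using assms(1) by (rule wnorm_add_le) auto
    ultimately show False
      using assms by auto
  qed
qed

lemma absv_le_wnorm: "1 \<le> t \<Longrightarrow> absv (y $ i) \<le> wnorm t y"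
  using exhaust_3[of i] mult_right_mono[of 1 t "absv (y $ 3)"]
  by (auto simp: wnorm_def)

lemma wnorm_le:
  assumes "1 \<le> t" "\<And>i. absv (y $ i) \<le> r"
  shows "wnorm t y \<le> t * r"
proof -
  have "r \<le> t * r"
    using assms(1) order_trans[OF absv_nonneg assms(2)] by (simp add: mult_right_mono[of 1 t r, simplified])
  then show ?thesis
    using assms by (auto simp: wnorm_le_iff intro: order_trans)
qed

lemma absv_sum_products_le:
  fixes a b c x y z :: "'a::nonarch_local_field"
  assumes "absv a * absv x \<le> r" "absv b * absv y \<le> r" "absv c * absv z \<le> r"
  shows "absv (a * x + b * y + c * z) \<le> r"
  using assms by (intro absv_add_le) (auto simp: absv_mult)

lemma absv_matrix_vector_le:
  fixes c :: "'a::nonarch_local_field^3^'n"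
  assumes "\<And>i j. absv (c $ i $ j) \<le> M" "\<And>i. absv (y $ i) \<le> r"
  shows "absv ((c *v y) $ i) \<le> M * r"
proof -
  have *: "absv (c $ i $ j) * absv (y $ j) \<le> M * r" for j
    using assms order_trans[OF absv_nonneg assms(1)] by (intro mult_mono) auto
  show ?thesis
    unfolding matrix_vector_mult_3_entry by (intro absv_sum_products_le *)
qed

section \<open>The two sides of the group\<close>

text \<open>The factor \<open>t\<close> is the norm of the third basis vector. For
  \<open>\<alpha>_pow \<omega> m\<close>, with \<open>q = absv \<omega> powi m\<close>, the
  inequality becomes \<open>t * q \<le> t / q\<close>, that is, \<open>0 \<le> m\<close>.\<close>

definition plus_side :: "real \<Rightarrow> 'e::nonarch_local_field mat3 \<Rightarrow> bool"
  where "plus_side t g \<longleftrightarrow> wnorm t (column 3 g) \<le> t * wnorm t (column 1 g)"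

text \<open>With \<open>t\<close> the value of \<open>vertex_scale\<close> below, these bounds hold on \<open>K\<close>; they imply that \<open>wnorm t\<close>
  does not increase, and unlike the definition of \<open>K\<close> they are visibly stable under inversion.\<close>

definition lattice_bounded :: "real \<Rightarrow> 'e::nonarch_local_field mat3 \<Rightarrow> bool"
  where "lattice_bounded t k \<longleftrightarrow>
    absv (k $ 1 $ 1) \<le> 1 \<and> absv (k $ 1 $ 2) \<le> 1 \<and> absv (k $ 1 $ 3) \<le> t \<and>
    t * absv (k $ 2 $ 1) \<le> 1 \<and> absv (k $ 2 $ 2) \<le> 1 \<and> absv (k $ 2 $ 3) \<le> 1 \<and>
    t * absv (k $ 3 $ 1) \<le> 1 \<and> t * absv (k $ 3 $ 2) \<le> 1 \<and> absv (k $ 3 $ 3) \<le> 1"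

primrec vertex_scale :: "'e::nonarch_local_field \<Rightarrow> vertex \<Rightarrow> real"
  where
    "vertex_scale \<omega> V0 = 1"
  | "vertex_scale \<omega> V1 = 1 / absv \<omega>"

lemma vertex_scale_ge_1: "uniformizer \<omega> \<Longrightarrow> 1 \<le> vertex_scale \<omega> v"
  using uniformizer_absv[of \<omega>] by (cases v) (auto simp: le_divide_eq)

lemma max_compact_lattice_bounded:
  assumes "uniformizer \<omega>" "k \<in> max_compact bar \<omega> v"
  shows "k \<in> U21 bar" "lattice_bounded (vertex_scale \<omega> v) k"
proof -
  have w: "0 < absv \<omega>"
    using uniformizer_absv[OF assms(1)] by simp
  \<comment> \<open>The valuation is discrete: elements of the maximal ideal are multiples of
    \<open>\<omega>\<close>, so the strict bound by 1 improves to a bound by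
    \<open>absv \<omega>\<close>.\<close>
  have m: "absv x \<le> absv \<omega>" if x: "x \<in> max_ideal" for x :: 'a
  proof -
    obtain y where "x = \<omega> * y" "absv y \<le> 1"
      using x assms(1) by (auto simp: uniformizer_def integers_def)
    then show ?thesis
      using w by (simp add: absv_mult mult_left_le)
  qed
  show "k \<in> U21 bar"
    using assms by (cases v) auto
  show "lattice_bounded (vertex_scale \<omega> v) k"
    using assms w by (cases v)
      (auto simp: lattice_bounded_def GL3_integers_def K1_lattice_def integers_def m absv_divide
        divide_right_mono)
qed

text \<open>The weight of the third coordinate is compensated by the bounds: the entry in row 1 and
  column 3 may reach \<open>t\<close>, and the entries of row 3 left of the diagonal gain a factor
  \<open>1 / t\<close>.\<close>

lemma wnorm_lattice_bounded_le:
  assumes t: "1 \<le> t" and k: "lattice_bounded t k"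
  shows "wnorm t (k *v y) \<le> wnorm t y"
proof -
  have y: "absv (y $ 1) \<le> wnorm t y" "absv (y $ 2) \<le> wnorm t y" "t * absv (y $ 3) \<le> wnorm t y"
    by (auto simp: wnorm_def)
  have y3: "absv (y $ 3) \<le> wnorm t y"
    using t by (rule absv_le_wnorm)
  have mono: "a * b \<le> wnorm t y" if "a \<le> 1" "b \<le> wnorm t y" "0 \<le> b" for a b
    using that mult_right_mono[of a 1 b] by simp
  have "absv (k $ 1 $ 3) * absv (y $ 3) \<le> t * absv (y $ 3)"
    using k by (auto simp: lattice_bounded_def intro: mult_right_mono)
  then have "absv (k $ 1 $ 3) * absv (y $ 3) \<le> wnorm t y"
    using y(3) by linarith
  then have 1: "absv ((k *v y) $ 1) \<le> wnorm t y"
    unfolding matrix_vector_mult_3_entry using k y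
    by (intro absv_sum_products_le) (auto simp: lattice_bounded_def intro: mono)
  have "absv (k $ 2 $ 1) \<le> 1"
    using k mult_right_mono[OF t, of "absv (k $ 2 $ 1)"] by (auto simp: lattice_bounded_def)
  then have 2: "absv ((k *v y) $ 2) \<le> wnorm t y"
    unfolding matrix_vector_mult_3_entry using k y y3
    by (intro absv_sum_products_le mono) (auto simp: lattice_bounded_def)
  have *: "absv a * absv b \<le> wnorm t y / t" if "t * absv a \<le> 1" "absv b \<le> wnorm t y" for a b :: 'a
    using mono[of "t * absv a" "absv b"] that t by (simp add: field_simps)
  have **: "absv (k $ 3 $ 3) * absv (y $ 3) \<le> wnorm t y / t"
  proof -
    have "absv (k $ 3 $ 3) * (t * absv (y $ 3)) \<le> wnorm t y"
      using k y(3) t mono[of "absv (k $ 3 $ 3)" "t * absv (y $ 3)"]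
      by (simp add: lattice_bounded_def)
    then show ?thesis
      using t by (simp add: field_simps)
  qed
  have "absv ((k *v y) $ 3) \<le> wnorm t y / t"
    unfolding matrix_vector_mult_3_entry using k y
    by (intro absv_sum_products_le * **) (auto simp: lattice_bounded_def)
  then have 3: "t * absv ((k *v y) $ 3) \<le> wnorm t y"
    using t by (simp add: field_simps)
  show ?thesis
    using 1 2 3 by (simp add: wnorm_le_iff)
qed

context unramified_quadratic
begin

text \<open>Inversion conjugates the entries and reflects them in the antidiagonal; the list of
  bounds is symmetric under this reflection.\<close>

lemma lattice_bounded_matrix_inv:
  assumes "k \<in> U21 bar" "lattice_bounded t k"
  shows "lattice_bounded t (matrix_inv k)"
  using assms(2) by (simp add: lattice_bounded_def U21_inv_entry[OF assms(1)])

text \<open>Neither \<open>k\<close> nor its inverse increases the norm.\<close>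

lemma wnorm_max_compact_mult:
  assumes "uniformizer \<omega>" "k \<in> max_compact bar \<omega> v"
  shows "wnorm (vertex_scale \<omega> v) (k *v y) = wnorm (vertex_scale \<omega> v) y"
proof -
  note k = max_compact_lattice_bounded[OF assms] and t = vertex_scale_ge_1[OF assms(1)]
  have "matrix_inv k *v (k *v y) = y"
    by (simp add: matrix_vector_mul_assoc matrix_inv_mult[OF U21_invertible[OF k(1)]])
  then show ?thesis
    using wnorm_lattice_bounded_le[OF t k(2), of y]
      wnorm_lattice_bounded_le[OF t lattice_bounded_matrix_inv[OF k], of "k *v y"]
    by (intro antisym) auto
qed

lemma plus_side_max_compact_mult:
  assumes "uniformizer \<omega>" "k \<in> max_compact bar \<omega> v"
  shows "plus_side (vertex_scale \<omega> v) (k ** g) \<longleftrightarrow> plus_side (vertex_scale \<omega> v) g"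
  by (simp add: plus_side_def column_matrix_mult wnorm_max_compact_mult[OF assms])

text \<open>The Hermitian product of columns 1 and 3 is 1. The two terms that contain an entry below
  the diagonal are smaller than 1, so the corner entries of the diagonal must be units.\<close>

lemma iwahori_bounds:
  assumes w: "uniformizer \<omega>" and i: "i \<in> iwahori bar \<omega> v"
  shows "absv (i $ 1 $ 1) = 1" "absv (i $ 3 $ 3) = 1"
    "absv (i $ 2 $ 1) < 1" "vertex_scale \<omega> v * absv (i $ 3 $ 1) < 1"
proof -
  define t where "t = vertex_scale \<omega> v"
  have k: "i \<in> max_compact bar \<omega> v" and ut: "upper_triangular_residue (reduction \<omega> v i)"
    using i by (auto simp: iwahori_def)
  note kb = max_compact_lattice_bounded[OF w k]
  have res: "absv x < 1" if "residue x = residue 0" for x :: 'e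
  proof -
    have "x \<in> residue x"
      by (simp add: residue_def max_ideal_def)
    then show ?thesis
      unfolding that by (simp add: residue_def max_ideal_def)
  qed
  have wpos: "0 < absv \<omega>"
    using uniformizer_absv[OF w] by simp
  show 21: "absv (i $ 2 $ 1) < 1"
  proof (cases v)
    case V0
    then show ?thesis
      using ut by (simp add: upper_triangular_residue_def res)
  next
    case V1
    then show ?thesis
      using k by (simp add: K1_lattice_def max_ideal_def)
  qed
  show 31: "vertex_scale \<omega> v * absv (i $ 3 $ 1) < 1"
  proof (cases v)
    case V0
    then show ?thesis
      using ut by (simp add: upper_triangular_residue_def res)
  next
    case V1
    then have "residue (i $ 3 $ 1 / \<omega>) = residue 0"
      using ut by (simp add: upper_triangular_residue_def)
    then show ?thesis
      using V1 res[of "i $ 3 $ 1 / \<omega>"] by (simp add: absv_divide)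
  qed
  have le: "absv (i $ 1 $ 1) \<le> 1" "absv (i $ 3 $ 3) \<le> 1" "absv (i $ 2 $ 3) \<le> 1"
    "absv (i $ 1 $ 3) \<le> t"
    using kb(2) by (auto simp: lattice_bounded_def t_def)
  have a: "absv (i $ 2 $ 1 * bar (i $ 2 $ 3)) < 1"
    using 21 le mult_mono[of "absv (i $ 2 $ 1)" "absv (i $ 2 $ 1)" "absv (i $ 2 $ 3)" 1]
    by (simp add: absv_mult)
  have b: "absv (i $ 3 $ 1 * bar (i $ 1 $ 3)) < 1"
    using 31 le mult_left_mono[of "absv (i $ 1 $ 3)" t "absv (i $ 3 $ 1)"]
    by (simp add: absv_mult t_def mult.commute)
  have "i $ 1 $ 1 * bar (i $ 3 $ 3) + i $ 2 $ 1 * bar (i $ 2 $ 3) + i $ 3 $ 1 * bar (i $ 1 $ 3) = 1"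
    using U21_column_form[OF kb(1), of 1 3] by (simp add: \<beta>_def)
  then have "\<not> absv (i $ 1 $ 1 * bar (i $ 3 $ 3)) < 1"
    using absv_add_less[OF absv_add_less[OF _ a] b] by (metis absv_1 order_less_irrefl)
  then have "1 \<le> absv (i $ 1 $ 1) * absv (i $ 3 $ 3)"
    by (simp add: absv_mult)
  then show "absv (i $ 1 $ 1) = 1" "absv (i $ 3 $ 3) = 1"
    using le mult_left_mono[of "absv (i $ 3 $ 3)" 1 "absv (i $ 1 $ 1)"]
      mult_right_mono[of "absv (i $ 1 $ 1)" 1 "absv (i $ 3 $ 3)"] by auto
qed

lemma plus_side_double_coset:
  assumes w: "uniformizer \<omega>"
    and g: "g \<in> double_coset (max_compact bar \<omega> v) (\<alpha>_pow \<omega> m) (iwahori bar \<omega> v)"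
  shows "plus_side (vertex_scale \<omega> v) g \<longleftrightarrow> 0 \<le> m"
proof -
  define t where "t = vertex_scale \<omega> v"
  have t: "1 \<le> t"
    unfolding t_def by (rule vertex_scale_ge_1[OF w])
  obtain k i where k: "k \<in> max_compact bar \<omega> v" and i: "i \<in> iwahori bar \<omega> v"
    and g_eq: "g = k ** (\<alpha>_pow \<omega> m ** i)"
    using g by (auto simp: double_coset_def simp flip: matrix_mul_assoc)
  have "i \<in> max_compact bar \<omega> v"
    using i by (simp add: iwahori_def)
  then have lb: "absv (i $ 1 $ 3) \<le> t" "absv (i $ 2 $ 3) \<le> 1"
    using max_compact_lattice_bounded(2)[OF w] by (auto simp: lattice_bounded_def t_def)
  note ib = iwahori_bounds[OF w i, folded t_def]
  define q where "q = absv \<omega> powi m"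
  have w01: "0 < absv \<omega>" "absv \<omega> < 1"
    using uniformizer_absv[OF w] by auto
  have q: "0 < q"
    using w01 by (simp add: q_def)
  have neg: "absv \<omega> powi (- m) = 1 / q"
    by (simp add: q_def power_int_minus divide_inverse)
  have q_le: "q \<le> 1" if "0 \<le> m"
    using w01 that by (simp add: q_def power_int_le_one)
  have q_gt: "1 < q" if "m < 0"
  proof -
    have "absv \<omega> powi (- m) < 1"
      using w01 that by (simp add: power_int_def power_Suc_less_one power_less_one_iff)
    then show ?thesis
      using neg q by simp
  qed
  let ?h = "\<alpha>_pow \<omega> m ** i"
  \<comment> \<open>Left multiplication by the power of \<open>\<alpha>\<close> scales the three
    rows by elements of absolute value \<open>1 / q\<close>, 1 and \<open>q\<close>.\<close>
  have 1: "wnorm t (column 1 ?h) = max (max (1 / q) (absv (i $ 2 $ 1))) (q * (t * absv (i $ 3 $ 1)))"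
    and 3: "wnorm t (column 3 ?h)
      = max (max (absv (i $ 1 $ 3) / q) (absv (i $ 2 $ 3))) (t * q)"
    by (simp_all add: wnorm_def column_def matrix_mult_3_entry \<alpha>_pow_def absv_mult absv_power_int
        neg ib q_def[symmetric] mult.left_commute)
  have "plus_side t g \<longleftrightarrow> plus_side t ?h"
    unfolding g_eq t_def by (rule plus_side_max_compact_mult[OF w k])
  also have "\<dots> \<longleftrightarrow> 0 \<le> m"
  proof (cases "0 \<le> m")
    case True
    \<comment> \<open>Here \<open>q \<le> 1\<close>: column 3 has norm at most \<open>t / q\<close>,
      and column 1 at least \<open>1 / q\<close>.\<close>
    have "1 \<le> 1 / q"
      using q_le[OF True] q by simp
    then have "1 \<le> t / q" 
      using t q by (simp add: field_simps)
    moreover have "t * q \<le> t / q"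
      using t q q_le[OF True] mult_le_one[of q q] by (simp add: field_simps)
    moreover have "absv (i $ 1 $ 3) / q \<le> t / q"
      using lb q by (simp add: divide_right_mono)
    ultimately have "wnorm t (column 3 ?h) \<le> t * (1 / q)"
      unfolding 3 using lb by auto
    also have "\<dots> \<le> t * wnorm t (column 1 ?h)"
      unfolding 1 using t by (intro mult_left_mono) auto
    finally show ?thesis
      using True by (simp add: plus_side_def)
  next
    case False
    \<comment> \<open>Here column 1 has norm below \<open>q\<close>, while the corner entry alone
      gives column 3 norm at least \<open>t * q\<close>.\<close>
    then have q1: "1 < q"
      using q_gt by simp
    have "q * (t * absv (i $ 3 $ 1)) < q"
      using ib(4) q by simp
    moreover have "1 / q < q"
      using q1 by (simp add: divide_less_eq less_1_mult)
    ultimately have "wnorm t (column 1 ?h) < q"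
      unfolding 1 using ib(3) q1 by auto
    then have "t * wnorm t (column 1 ?h) < t * q"
      using t by simp
    also have "\<dots> \<le> wnorm t (column 3 ?h)"
      unfolding 3 by simp
    finally show ?thesis
      using False by (simp add: plus_side_def)
  qed
  finally show ?thesis
    by (simp add: t_def)
qed

text \<open>If \<open>x $ a $ b\<close> is a large entry of \<open>x\<close> of maximal absolute value, then \<open>x\<close> is, up to a
  bounded error, the product of its column \<open>b\<close> and its row \<open>a\<close> divided by \<open>x $ a $ b\<close>,
  because its minors are no larger than its entries.  That row decides the side of \<open>c ** x\<close> for
  all \<open>c\<close> in a bounded set.\<close>

lemma plus_side_iff_of_large:
  assumes t: "1 \<le> t" and M: "1 \<le> M"
    and c: "c \<in> U21 bar" "\<And>i j. absv (c $ i $ j) \<le> M"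
    and x: "x \<in> U21 bar" "\<And>i j. absv (x $ i $ j) \<le> absv (x $ a $ b)"
    and large: "t\<^sup>2 * M\<^sup>2 < absv (x $ a $ b)"
  shows "plus_side t (c ** x) \<longleftrightarrow> absv (x $ a $ 3) \<le> t * absv (x $ a $ 1)"
proof -
  define N where "N = absv (x $ a $ b)"
  define w where "w j = x $ a $ j / x $ a $ b" for j
  define u where "u = column b x"
  define e where "e j = column j x - w j *s u" for j
  define L where "L = wnorm t (c *v u)"
  have "1 \<le> t\<^sup>2 * M\<^sup>2"
    using t M mult_mono[of 1 "t\<^sup>2" 1 "M\<^sup>2"] by (simp add: one_le_power)
  then have N: "1 < N" "t\<^sup>2 * M\<^sup>2 < N"
    using large by (auto simp: N_def)
  have nz: "x $ a $ b \<noteq> 0"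
    using N by (auto simp: N_def)
  \<comment> \<open>The error of the rank one approximation is a minor divided by the largest entry,
    and no minor exceeds that entry.\<close>
  have e: "absv (e j $ i) \<le> 1" for i j
  proof -
    have "e j $ i = (x $ i $ j * x $ a $ b - x $ i $ b * x $ a $ j) / x $ a $ b"
      using nz by (simp add: e_def u_def w_def column_def field_simps)
    then show ?thesis
      using U21_absv_minor_le[OF x, of i j a b] N by (simp add: absv_divide N_def divide_le_eq)
  qed
  have ce: "wnorm t (c *v e j) \<le> t * M" for j
    using absv_matrix_vector_le[OF c(2), of "e j" 1] e by (intro wnorm_le t) simp
  have col: "column j (c ** x) = w j *s (c *v u) + c *v e j" for j
    by (simp add: column_matrix_mult e_def matrix_vector_mult_diff_distrib vector_scalar_commute)
  \<comment> \<open>The entry of size \<open>N\<close> is recovered from \<open>c *v u\<close> by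
    the inverse of \<open>c\<close>, whose entries are again bounded by \<open>M\<close>.\<close>
  have "N / M \<le> L"
  proof -
    have "x $ a $ b = (matrix_inv c *v (c *v u)) $ a"
      by (simp add: matrix_vector_mul_assoc matrix_inv_mult[OF U21_invertible[OF c(1)]]
          u_def column_def)
    moreover have "absv ((matrix_inv c *v (c *v u)) $ a) \<le> M * L"
      unfolding L_def using c(2)
      by (intro absv_matrix_vector_le absv_le_wnorm t) (simp add: U21_inv_entry[OF c(1)])
    ultimately show ?thesis
      using M by (simp add: N_def field_simps)
  qed
  then have "N \<le> L * M"
    using M by (simp add: field_simps)
  then have "(t * t * M) * M < L * M"
    using N by (simp add: power2_eq_square ac_simps)
  \<comment> \<open>The errors \<open>c *v e j\<close> have norm at most \<open>t * M\<close>; the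
    second factor \<open>t\<close> pays for the factor in \<open>plus_side\<close>.\<close>
  then have L: "t * t * M < L"
    using M by simp
  have "t * M \<le> t * t * M"
    using t M by simp
  then have tM: "t * M < L"
    using L by linarith
  have "0 < t * M"
    using t M by simp
  then have Lpos: "0 < L"
    using tM by linarith
  \<comment> \<open>The Hermitian product of row \<open>a\<close> with itself is 0 or 1. If the
    middle entry alone had size \<open>N > 1\<close>, its square could not be cancelled.\<close>
  have max: "absv (x $ a $ 1) = N \<or> absv (x $ a $ 3) = N"
  proof (rule ccontr)
    assume *: "\<not> ?thesis"
    then have less: "absv (x $ a $ 1) < N" "absv (x $ a $ 3) < N"
      using x(2) by (auto simp: N_def less_le)
    then have "b = 2"
      using exhaust_3[of b] by (auto simp: N_def)
    have 13: "absv (x $ a $ 1) * absv (x $ a $ 3) < N * N"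
      using less by (intro mult_strict_mono') auto
    have "(1::real) * 1 < N * N"
      using N by (intro mult_strict_mono) auto
    then have row: "absv (if a = opp a then 1 else 0 :: 'e) < N * N"
      by auto
    have "x $ a $ 2 * bar (x $ a $ 2) = (if a = opp a then 1 else 0)
        + (- (x $ a $ 1 * bar (x $ a $ 3)) + - (x $ a $ 3 * bar (x $ a $ 1)))"
      using U21_row_form[OF x(1), of a a] by (auto simp: algebra_simps eq_diff_eq)
    moreover have "absv (- (x $ a $ 1 * bar (x $ a $ 3))) < N * N"
      "absv (- (x $ a $ 3 * bar (x $ a $ 1))) < N * N"
      using 13 by (simp_all add: absv_mult mult.commute)
    ultimately have "absv (x $ a $ 2 * bar (x $ a $ 2)) < N * N"
      using absv_add_less[OF row absv_add_less] by (metis (no_types))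
    then show False
      by (simp add: absv_mult N_def \<open>b = 2\<close>)
  qed
  have absw: "absv (w j) = absv (x $ a $ j) / N" for j
    by (simp add: w_def absv_divide N_def)
  show ?thesis
  proof (cases "absv (x $ a $ 3) \<le> t * absv (x $ a $ 1)")
    case True
    have "N \<le> t * N"
      using mult_right_mono[OF t, of N] N by linarith
    \<comment> \<open>If only the third entry has size \<open>N\<close>, the assumed inequality
      still gives the first entry size at least \<open>N / t\<close>.\<close>
    then have "N \<le> t * absv (x $ a $ 1)"
      using max True by auto
    then have "1 \<le> t * absv (w 1)"
      using N by (simp add: absw)
    then have "1 * L \<le> t * absv (w 1) * L"
      using Lpos by (intro mult_right_mono) auto
    then have L1: "L \<le> t * (absv (w 1) * L)"
      by (simp only: mult.assoc mult_1)
    then have "t * (t * M) < t * (absv (w 1) * L)"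
      using L by (simp add: mult.assoc)
    then have "t * M < absv (w 1) * L"
      using t by simp
    then have 1: "wnorm t (column 1 (c ** x)) = absv (w 1) * L"
      unfolding col using ce[of 1] t
      by (subst wnorm_add_eq) (auto simp: wnorm_scale L_def)
    have "absv (w 3) * L \<le> t * (absv (w 1) * L)"
    proof -
      have "absv (w 3) \<le> t * absv (w 1)"
        using True N by (simp add: absw divide_right_mono)
      then have "absv (w 3) * L \<le> t * absv (w 1) * L"
        using Lpos by (intro mult_right_mono) auto
      then show ?thesis
        by (simp only: mult.assoc)
    qed
    then have "wnorm t (column 3 (c ** x)) \<le> t * (absv (w 1) * L)"
      unfolding col using ce[of 3] tM L1 t by (intro wnorm_add_le) (auto simp: wnorm_scale L_def)
    then show ?thesis
      using True by (simp add: plus_side_def 1)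
  next
    case False
    then have "t * absv (x $ a $ 1) < absv (x $ a $ 3)"
      by simp
    moreover have "absv (x $ a $ 1) \<le> t * absv (x $ a $ 1)"
      using t mult_right_mono[of 1 t "absv (x $ a $ 1)"] by simp
    ultimately have 3: "absv (x $ a $ 3) = N"
      using max x(2)[of a 3] by (auto simp: N_def)
    have w3: "absv (w 3) = 1" and w1: "t * absv (w 1) < 1"
      using 3 False N by (auto simp: absw)
    have n3: "wnorm t (column 3 (c ** x)) = L"
      unfolding col using ce[of 3] t tM
      by (subst wnorm_add_eq) (auto simp: wnorm_scale L_def w3)
    have "t * (absv (w 1) * L) < L"
      using mult_strict_right_mono[OF w1 Lpos] by (simp only: mult.assoc mult_1)
    moreover have "t * (t * M) < L"
      using L by (simp only: mult.assoc)
    ultimately have small: "t * max (absv (w 1) * L) (t * M) < L"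
      by (simp add: max_def)
    have "wnorm t (column 1 (c ** x)) \<le> max (absv (w 1) * L) (t * M)"
      unfolding col using ce[of 1] t
      by (intro wnorm_add_le) (auto simp: wnorm_scale L_def)
    then have "t * wnorm t (column 1 (c ** x)) \<le> t * max (absv (w 1) * L) (t * M)"
      using t by (intro mult_left_mono) auto
    then have "t * wnorm t (column 1 (c ** x)) < L"
      using small by linarith
    then show ?thesis
      using False by (simp add: plus_side_def n3)
  qed
qed

text \<open>If the largest entry of \<open>x\<close> exceeded the bound, one criterion in
  \<open>x\<close> alone would decide the side of both \<open>c ** x\<close> and
  \<open>d ** x\<close>.\<close>

lemma absv_le_of_both_sides:
  assumes t: "1 \<le> t" and M: "1 \<le> M"
    and c: "c \<in> U21 bar" "\<And>i j. absv (c $ i $ j) \<le> M" "plus_side t (c ** x)"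
    and d: "d \<in> U21 bar" "\<And>i j. absv (d $ i $ j) \<le> M" "\<not> plus_side t (d ** x)"
    and x: "x \<in> U21 bar"
  shows "absv (x $ i $ j) \<le> t\<^sup>2 * M\<^sup>2"
proof -
  obtain p where p: "\<And>q. absv (x $ fst q $ snd q) \<le> absv (x $ fst p $ snd p)"
  proof -
    let ?A = "range (\<lambda>q. absv (x $ fst q $ snd q))"
    have "Max ?A \<in> ?A"
      by (intro Max_in) auto
    then obtain p where "Max ?A = absv (x $ fst p $ snd p)"
      by blast
    then show thesis
      using Max_ge[of ?A] by (intro that[of p]) auto
  qed
  then have max: "absv (x $ i $ j) \<le> absv (x $ fst p $ snd p)" for i j
    using p[of "(i, j)"] by simp
  have "\<not> t\<^sup>2 * M\<^sup>2 < absv (x $ fst p $ snd p)"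
    using plus_side_iff_of_large[OF t M c(1,2) x max] plus_side_iff_of_large[OF t M d(1,2) x max]
      c(3) d(3) by blast
  then show ?thesis
    using max[of i j] by linarith
qed

end

section \<open>Translates of a function in the compact induction\<close>

text \<open>The distance on matrices is a Euclidean combination of the entry distances. Boxes
  describe the same topology and keep the ultrametric inequality available entrywise.\<close>

lemma open_entry_box:
  fixes g :: "'a::nonarch_local_field^'n^'m"
  shows "open {h. \<forall>i j. absv (h $ i $ j - g $ i $ j) < r}"
proof -
  have "open {h :: 'a^'n^'m. \<forall>i. h $ i \<in> {y. \<forall>j. y $ j \<in> ball (g $ i $ j) r}}"
    by (intro open_vector_box allI) auto
  then show ?thesis
    by (simp add: dist_absv absv_diff_commute)
qed

lemma entry_box_subset_open:
  fixes g :: "'a::nonarch_local_field mat3"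
  assumes "open T" "g \<in> T"
  obtains r where "0 < r" "\<And>h. \<forall>i j. absv (h $ i $ j - g $ i $ j) < r \<Longrightarrow> h \<in> T"
proof -
  obtain e where e: "0 < e" "ball g e \<subseteq> T"
    using assms open_contains_ball by blast
  have dist3: "dist x y \<le> dist (x $ 1) (y $ 1) + dist (x $ 2) (y $ 2) + dist (x $ 3) (y $ 3)"
    for x y :: "'b::metric_space^3"
    using L2_set_le_sum[of UNIV "\<lambda>i. dist (x $ i) (y $ i)"] by (simp add: dist_vec_def sum_3)
  show thesis
  proof (rule that[of "e / 9"])
    fix h assume "\<forall>i j. absv (h $ i $ j - g $ i $ j) < e / 9"
    then have "dist (g $ i $ j) (h $ i $ j) < e / 9" for i j
      by (simp add: dist_absv absv_diff_commute)
    then have "dist (g $ i) (h $ i) < e / 9 + e / 9 + e / 9" for i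
      by (intro le_less_trans[OF dist3] add_strict_mono)
    then have "dist (g $ 1) (h $ 1) + dist (g $ 2) (h $ 2) + dist (g $ 3) (h $ 3)
        < (e / 9 + e / 9 + e / 9) + (e / 9 + e / 9 + e / 9) + (e / 9 + e / 9 + e / 9)"
      by (intro add_strict_mono)
    then have "dist g h < e"
      using dist3[of g h] by simp
    then show "h \<in> T"
      using e by auto
  qed (use e in simp)
qed

lemma compact_entries_bounded:
  fixes C :: "('a::nonarch_local_field^'n^'m) set"
  assumes "compact C"
  obtains M where "1 \<le> M" "\<And>c i j. c \<in> C \<Longrightarrow> absv (c $ i $ j) \<le> M"
proof -
  obtain e where e: "\<And>c. c \<in> C \<Longrightarrow> dist 0 c \<le> e"
    using compact_imp_bounded[OF assms] bounded_any_center[of C 0] by auto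
  have *: "absv (c $ i $ j) \<le> dist 0 c" for c :: "'a^'n^'m" and i j
    using dist_vec_nth_le[of "0 $ i" j "c $ i"] dist_vec_nth_le[of 0 i c]
    by (simp add: absv_eq_dist dist_commute)
  show thesis
  proof (rule that[of "max 1 e"])
    show "absv (c $ i $ j) \<le> max 1 e" if "c \<in> C" for c i j
      using e[OF that] *[of c i j] by linarith
  qed simp
qed

lemma absv_matrix_mult_le:
  fixes A :: "'a::nonarch_local_field^3^'n"
  assumes "\<And>i j. absv (A $ i $ j) \<le> r" "\<And>i j. absv (B $ i $ j) \<le> s"
  shows "absv ((A ** B) $ i $ j) \<le> r * s"
proof -
  have *: "absv (A $ i $ l) * absv (B $ l $ j) \<le> r * s" for l
    using assms order_trans[OF absv_nonneg assms(1)] by (intro mult_mono) auto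
  show ?thesis
    unfolding matrix_mult_3_entry by (intro absv_sum_products_le *)
qed

lemma finite_matrices_entries_in:
  assumes "finite S"
  shows "finite {A :: 'a^'n^'m. \<forall>i j. A $ i $ j \<in> S}"
proof -
  let ?F = "\<lambda>f :: 'm \<times> 'n \<Rightarrow> 'a. (\<chi> i j. f (i, j)) :: 'a^'n^'m"
  have "{A :: 'a^'n^'m. \<forall>i j. A $ i $ j \<in> S} \<subseteq> ?F ` (UNIV \<rightarrow>\<^sub>E S)"
  proof
    fix A :: "'a^'n^'m" assume "A \<in> {A. \<forall>i j. A $ i $ j \<in> S}"
    then have "(\<lambda>(i, j). A $ i $ j) \<in> UNIV \<rightarrow>\<^sub>E S"
      by auto
    moreover have "A = ?F (\<lambda>(i, j). A $ i $ j)"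
      by (simp add: vec_eq_iff)
    ultimately show "A \<in> ?F ` (UNIV \<rightarrow>\<^sub>E S)"
      by blast
  qed
  then show ?thesis
    by (rule finite_subset) (intro finite_imageI finite_PiE finite_class.finite_UNIV assms)
qed

text \<open>A Lebesgue number argument: finitely many boxes on which \<open>f\<close> is constant
  cover \<open>C\<close>, and \<open>d\<close> is their smallest radius.\<close>

lemma compact_induction_uniformly_constant:
  assumes "f \<in> compact_induction G K \<sigma>" "compact C" "C \<subseteq> G"
  obtains d where "0 < d"
    "\<And>c g. c \<in> C \<Longrightarrow> g \<in> G \<Longrightarrow> \<forall>i j. absv (g $ i $ j - c $ i $ j) < d \<Longrightarrow> f g = f c"
proof -
  let ?box = "\<lambda>c r. {h. \<forall>i j. absv (h $ i $ j - c $ i $ j) < r}"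
  have "\<exists>r. 0 < r \<and> (\<forall>g\<in>G \<inter> ?box c r. f g = f c)" if "c \<in> C" for c
  proof -
    obtain U where U: "openin (top_of_set G) U" "c \<in> U" "\<forall>h\<in>U. f h = f c"
      using assms \<open>c \<in> C\<close> unfolding compact_induction_def by blast
    then obtain T where T: "open T" "U = G \<inter> T"
      by (auto simp: openin_open)
    then obtain r where r: "0 < r" "\<And>h. \<forall>i j. absv (h $ i $ j - c $ i $ j) < r \<Longrightarrow> h \<in> T"
      using entry_box_subset_open[of T c] U(2) by blast
    have "f g = f c" if "g \<in> G \<inter> ?box c r" for g
    proof -
      have "g \<in> U"
        using that r(2)[of g] T(2) by blast
      then show ?thesis
        using U(3) by blast
    qed
    then show ?thesis
      using r(1) by blast
  qed
  then have "\<forall>c\<in>C. \<exists>r. 0 < r \<and> (\<forall>g\<in>G \<inter> ?box c r. f g = f c)"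
    by blast
  then obtain r where "\<forall>c\<in>C. 0 < r c \<and> (\<forall>g\<in>G \<inter> ?box c (r c). f g = f c)"
    unfolding bchoice_iff by blast
  then have r: "\<And>c. c \<in> C \<Longrightarrow> 0 < r c"
    "\<And>c g. c \<in> C \<Longrightarrow> g \<in> G \<Longrightarrow> g \<in> ?box c (r c) \<Longrightarrow> f g = f c"
    by blast+
  have "C \<subseteq> (\<Union>c\<in>C. ?box c (r c))"
    using r(1) by auto
  then obtain D where D: "D \<subseteq> C" "finite D" "C \<subseteq> (\<Union>c\<in>D. ?box c (r c))"
    by (rule compactE_image[OF assms(2) open_entry_box])
  \<comment> \<open>Inserting 1 keeps the minimum meaningful when \<open>D\<close> is empty.\<close>
  define d where "d = Min (insert 1 (r ` D))"
  have d: "0 < d" "\<And>c. c \<in> D \<Longrightarrow> d \<le> r c"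
    using D r(1) by (auto simp: d_def)
  show thesis
  proof (rule that[OF d(1)])
    fix c g assume c: "c \<in> C" and g: "g \<in> G" and close: "\<forall>i j. absv (g $ i $ j - c $ i $ j) < d"
    obtain c0 where c0: "c0 \<in> D" "c \<in> ?box c0 (r c0)"
      using D(3) c by blast
    \<comment> \<open>By the ultrametric inequality \<open>g\<close> stays in the very box that
      contains \<open>c\<close>, so the radii need no halving.\<close>
    have "absv ((g $ i $ j - c $ i $ j) + (c $ i $ j - c0 $ i $ j)) < r c0" for i j
      using close d(2)[OF c0(1)] c0(2) by (intro absv_add_less) (auto intro: less_le_trans)
    then have "g \<in> ?box c0 (r c0)"
      by simp
    moreover have "c \<in> G" "c0 \<in> C"
      using c c0 D assms(3) by auto
    ultimately show "f g = f c"
      using r(2)[of c0 g] r(2)[of c0 c] g c0(2) by simp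
  qed
qed

definition straddles :: "real \<Rightarrow> ('e::nonarch_local_field mat3 \<Rightarrow> 'w::zero) \<Rightarrow> bool"
  where "straddles t f \<longleftrightarrow>
    (\<exists>g. f g \<noteq> 0 \<and> plus_side t g) \<and> (\<exists>g. f g \<noteq> 0 \<and> \<not> plus_side t g)"

section \<open>Finiteness of the translates that meet both sides\<close>

context unramified_quadratic
begin

lemma U21_cancel_right:
  assumes "h \<in> U21 bar"
  shows "g ** h \<in> U21 bar \<longleftrightarrow> g \<in> U21 bar"
proof
  have "g ** h ** matrix_inv h = g"
    by (simp add: matrix_inv_mult U21_invertible[OF assms] flip: matrix_mul_assoc)
  then show "g \<in> U21 bar" if "g ** h \<in> U21 bar"
    using U21_mult[OF that U21_matrix_inv[OF assms]] by simp
qed (simp add: U21_mult assms)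

text \<open>The difference of \<open>g ** h'\<close> and \<open>g ** h\<close> is
  \<open>g ** h\<close> times \<open>matrix_inv h\<close> times \<open>h' - h\<close>. The three
  factors are bounded by \<open>M\<close>, \<open>r\<close> and \<open>s\<close>, so
  \<open>g\<close> itself needs no bound.\<close>

lemma right_translation_eq_of_close:
  assumes f: "\<And>c g. c \<in> C \<Longrightarrow> g \<in> U21 bar \<Longrightarrow> \<forall>i j. absv (g $ i $ j - c $ i $ j) < d \<Longrightarrow> f g = f c"
    and M: "\<And>c i j. c \<in> C \<Longrightarrow> absv (c $ i $ j) \<le> M"
    and h: "h \<in> U21 bar" "\<And>i j. absv (h $ i $ j) \<le> r"
    and h': "h' \<in> U21 bar" "\<And>i j. absv (h' $ i $ j - h $ i $ j) \<le> s"
    and d: "M * (r * s) < d"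
    and g: "g \<in> U21 bar" "g ** h \<in> C"
  shows "f (g ** h') = f (g ** h)"
proof (rule f)
  show "g ** h' \<in> U21 bar"
    using g h' by (intro U21_mult)
  have "(g ** h) ** (matrix_inv h ** (h' - h)) = g ** (h ** matrix_inv h) ** (h' - h)"
    by (simp only: matrix_mul_assoc)
  also have "\<dots> = g ** (h' - h)"
    by (simp add: matrix_inv_mult U21_invertible[OF h(1)])
  finally have eq: "(g ** h') $ i $ j - (g ** h) $ i $ j
      = ((g ** h) ** (matrix_inv h ** (h' - h))) $ i $ j" for i j
    by (simp add: matrix_mult_3_entry algebra_simps)
  have "absv (((g ** h) ** (matrix_inv h ** (h' - h))) $ i $ j) \<le> M * (r * s)" for i j
    using M[OF g(2)] h h'(2) by (intro absv_matrix_mult_le) (auto simp: U21_inv_entry)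
  then show "\<forall>i j. absv ((g ** h') $ i $ j - (g ** h) $ i $ j) < d"
    unfolding eq using d by (auto intro: le_less_trans)
qed (rule g)

text \<open>Rounding every entry of \<open>h\<close> to a finite net leaves finitely many classes,
  and the translate depends only on the class of \<open>h\<close>.\<close>

lemma finite_bounded_translates:
  assumes f: "f \<in> compact_induction (U21 bar) K \<sigma>"
  shows "finite ((\<lambda>h. right_translation h f) ` {h \<in> U21 bar. \<forall>i j. absv (h $ i $ j) \<le> B})"
    (is "finite (?R ` ?H)")
proof -
  obtain C where C: "compact C" "C \<subseteq> U21 bar" "\<And>g. g \<notin> C \<Longrightarrow> f g = 0"
    using f unfolding compact_induction_def by blast
  have f0: "f g = 0" if "g \<notin> U21 bar" for g
    using C that by blast
  obtain M where M: "1 \<le> M" "\<And>c i j. c \<in> C \<Longrightarrow> absv (c $ i $ j) \<le> M"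
    using compact_entries_bounded[OF C(1)] by blast
  obtain d where d: "0 < d"
    "\<And>c g. c \<in> C \<Longrightarrow> g \<in> U21 bar \<Longrightarrow> \<forall>i j. absv (g $ i $ j - c $ i $ j) < d \<Longrightarrow> f g = f c"
    using compact_induction_uniformly_constant[OF f C(1,2)] by blast
  define r where "r = max 1 B"
  \<comment> \<open>With this mesh \<open>M * (r * e)\<close> equals \<open>d / 2\<close>.\<close>
  define e where "e = d / (2 * M * r)"
  have r: "1 \<le> r" "B \<le> r"
    by (auto simp: r_def)
  have e: "0 < e" "M * (r * e) < d"
    using d M(1) r by (auto simp: e_def)
  obtain S :: "'e set" where S: "finite S" "\<And>x. absv x \<le> B \<Longrightarrow> \<exists>y\<in>S. absv (x - y) < e"
    using finite_absv_net[OF e(1)] by blast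
  then obtain rnd where rnd: "\<And>x. absv x \<le> B \<Longrightarrow> rnd x \<in> S \<and> absv (x - rnd x) < e"
    by metis
  define \<phi> :: "'e mat3 \<Rightarrow> 'e mat3" where "\<phi> h = (\<chi> i j. rnd (h $ i $ j))" for h
  have "finite (\<phi> ` ?H)"
    by (rule finite_subset[OF _ finite_matrices_entries_in[OF S(1)]]) (auto simp: \<phi>_def rnd)
  have close: "absv (h' $ i $ j - h $ i $ j) \<le> e" if "h \<in> ?H" "h' \<in> ?H" "\<phi> h = \<phi> h'" for h h' i j
  proof -
    have "rnd (h $ i $ j) = rnd (h' $ i $ j)"
      using that(3) by (simp add: \<phi>_def vec_eq_iff)
    then have "absv (h' $ i $ j - rnd (h' $ i $ j) - (h $ i $ j - rnd (h' $ i $ j))) \<le> e"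
      using that rnd[of "h $ i $ j"] rnd[of "h' $ i $ j"] by (intro absv_diff_le[of "_ - _" _ "_ - _"]) auto
    then show ?thesis
      by simp
  qed
  \<comment> \<open>The comparison needs one of the two products in \<open>C\<close>; the other case
    follows by exchanging \<open>h\<close> and \<open>h'\<close>, and outside \<open>C\<close> both
    values vanish.\<close>
  have half: "f (g ** h') = f (g ** h)"
    if "h \<in> ?H" "h' \<in> ?H" "\<phi> h = \<phi> h'" "g \<in> U21 bar" "g ** h \<in> C" for g h h'
  proof (rule right_translation_eq_of_close[OF d(2) M(2), where r = r and s = e])
    show "absv (h $ i $ j) \<le> r" for i j
      using that(1) r(2) by (auto intro: order_trans)
  qed (use that e close in auto)
  have "?R h = ?R h'" if hh: "h \<in> ?H" "h' \<in> ?H" "\<phi> h = \<phi> h'" for h h'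
  proof
    fix g
    show "?R h g = ?R h' g"
    proof (cases "g \<in> U21 bar")
      case True
      then consider "g ** h \<in> C" | "g ** h' \<in> C" | "g ** h \<notin> C" "g ** h' \<notin> C"
        by blast
      then show ?thesis
      proof cases
        case 1
        then show ?thesis
          using half[of h h' g] hh True by (simp add: right_translation_def)
      next
        case 2
        then show ?thesis
          using half[of h' h g] hh True by (simp add: right_translation_def)
      next
        case 3
        then show ?thesis
          using C(3) by (simp add: right_translation_def)
      qed
    next
      case False
      then show ?thesis
        using hh by (simp add: right_translation_def f0 U21_cancel_right)
    qed
  qed
  then have "?R ` ?H \<subseteq> (\<lambda>y. ?R (inv_into ?H \<phi> y)) ` \<phi> ` ?H"
    by (smt (verit, best) f_inv_into_f image_iff image_subsetI inv_into_into)
  then show ?thesis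
    using \<open>finite (\<phi> ` ?H)\<close> finite_surj by blast
qed

lemma finite_straddling_translates:
  assumes f: "f \<in> compact_induction (U21 bar) K \<sigma>" and t: "1 \<le> t"
  shows "finite {right_translation h f | h. h \<in> U21 bar \<and> straddles t (right_translation h f)}"
proof -
  obtain C where C: "compact C" "C \<subseteq> U21 bar" "\<And>g. g \<notin> C \<Longrightarrow> f g = 0"
    using f unfolding compact_induction_def by blast
  obtain M where M: "1 \<le> M" "\<And>c i j. c \<in> C \<Longrightarrow> absv (c $ i $ j) \<le> M"
    using compact_entries_bounded[OF C(1)] by blast
  have "absv (h $ i $ j) \<le> t\<^sup>2 * M\<^sup>2" if h: "h \<in> U21 bar" and s: "straddles t (right_translation h f)"
    for h i j
  proof -
    obtain g g' where "g ** h \<in> C" "plus_side t g" "g' ** h \<in> C" "\<not> plus_side t g'"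
      using s C(3) unfolding straddles_def right_translation_def by blast
    moreover have "k ** h ** matrix_inv h = k" for k :: "'e mat3"
      by (simp add: matrix_inv_mult U21_invertible[OF h] flip: matrix_mul_assoc)
    \<comment> \<open>The previous bound is used for \<open>x = matrix_inv h\<close> and the
      elements \<open>g ** h\<close> and \<open>g' ** h\<close> of \<open>C\<close>, whose products
      with \<open>x\<close> are \<open>g\<close> and \<open>g'\<close>.\<close>
    ultimately have "absv (matrix_inv h $ opp j $ opp i) \<le> t\<^sup>2 * M\<^sup>2"
      using absv_le_of_both_sides[OF t M(1), of "g ** h" "matrix_inv h" "g' ** h"] C(2) M(2)
        U21_matrix_inv[OF h] by auto
    then show ?thesis
      by (simp add: U21_inv_entry[OF h])
  qed
  then have "{right_translation h f | h. h \<in> U21 bar \<and> straddles t (right_translation h f)}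
      \<subseteq> (\<lambda>h. right_translation h f) ` {h \<in> U21 bar. \<forall>i j. absv (h $ i $ j) \<le> t\<^sup>2 * M\<^sup>2}"
    by auto
  then show ?thesis
    using finite_bounded_translates[OF f] finite_subset by blast
qed

lemma plus_side_locally_constant:
  assumes g: "g \<in> U21 bar" and t: "1 \<le> t"
  obtains U where "openin (top_of_set (U21 bar)) U" "g \<in> U"
    "\<And>h. h \<in> U \<Longrightarrow> plus_side t h \<longleftrightarrow> plus_side t g"
proof -
  have pos: "0 < wnorm t (column j g)" for j
  proof (rule ccontr)
    assume "\<not> ?thesis"
    then have "absv (column j g $ i) \<le> 0" for i
      using absv_le_wnorm[OF t, of "column j g" i] by linarith
    then have "absv (g $ i $ j) \<le> 0" for i
      by (simp add: column_def)
    then have "g $ i $ j = 0" for i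
      by (metis absv_eq_0_iff absv_nonneg antisym)
    then have "(matrix_inv g ** g) $ j $ j = 0"
      by (simp add: matrix_mult_3_entry)
    then show False
      by (simp add: matrix_inv_mult U21_invertible[OF g] mat_def)
  qed
  define m where "m = min (wnorm t (column 1 g)) (wnorm t (column 3 g))"
  \<comment> \<open>Passing from entries to \<open>wnorm t\<close> costs a factor \<open>t\<close>,
    so columns move by at most \<open>m / 2\<close>, less than their norm.\<close>
  define U where "U = U21 bar \<inter> {h. \<forall>i j. absv (h $ i $ j - g $ i $ j) < m / (2 * t)}"
  have m: "0 < m"
    using pos by (simp add: m_def)
  have col: "wnorm t (column j h) = wnorm t (column j g)"
    if "h \<in> U" "m \<le> wnorm t (column j g)" for h j
  proof -
    have "wnorm t (column j h - column j g) \<le> t * (m / (2 * t))"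
      using that(1) by (intro wnorm_le t) (auto simp: U_def column_def intro: less_imp_le)
    also have "\<dots> < wnorm t (column j g)"
      using that(2) m t by simp
    finally have "wnorm t (column j g + (column j h - column j g)) = wnorm t (column j g)"
      using t by (intro wnorm_add_eq) auto
    then show ?thesis
      by simp
  qed
  show thesis
  proof (rule that)
    show "openin (top_of_set (U21 bar)) U"
      unfolding U_def by (intro openin_open_Int open_entry_box)
    show "g \<in> U"
      using g m t by (simp add: U_def)
    show "plus_side t h \<longleftrightarrow> plus_side t g" if "h \<in> U" for h
      using col[OF that, of 1] col[OF that, of 3] by (simp add: plus_side_def m_def)
  qed
qed

end

section \<open>Restriction of functions to one side\<close>

definition restrict_plus :: "real \<Rightarrow> ('e::nonarch_local_field mat3 \<Rightarrow> 'w::zero) \<Rightarrow> 'e mat3 \<Rightarrow> 'w"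
  where "restrict_plus t f = (\<lambda>g. if plus_side t g then f g else 0)"

lemma restrict_plus_add:
  "restrict_plus t (f + f') = restrict_plus t f + restrict_plus t f'"
  for f :: "_ \<Rightarrow> 'w::ab_group_add"
  by (auto simp: restrict_plus_def)

lemma compact_inductionI:
  assumes "\<And>g. g \<notin> G \<Longrightarrow> f g = 0" "\<And>k g. k \<in> K \<Longrightarrow> g \<in> G \<Longrightarrow> f (k ** g) = \<sigma> k (f g)"
    "\<And>g. g \<in> G \<Longrightarrow> \<exists>U. openin (top_of_set G) U \<and> g \<in> U \<and> (\<forall>h\<in>U. f h = f g)"
    "compact C" "C \<subseteq> G" "\<And>g. g \<notin> C \<Longrightarrow> f g = 0"
  shows "f \<in> compact_induction G K \<sigma>"
  unfolding compact_induction_def mem_Collect_eq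
  by (intro conjI allI impI ballI exI[of _ C] assms)

lemma compact_inductionD:
  assumes "f \<in> compact_induction G K \<sigma>"
  shows "g \<notin> G \<Longrightarrow> f g = 0" "k \<in> K \<Longrightarrow> g \<in> G \<Longrightarrow> f (k ** g) = \<sigma> k (f g)"
    "g \<in> G \<Longrightarrow> \<exists>U. openin (top_of_set G) U \<and> g \<in> U \<and> (\<forall>h\<in>U. f h = f g)"
    "\<exists>C. compact C \<and> C \<subseteq> G \<and> (\<forall>g. g \<notin> C \<longrightarrow> f g = 0)"
  using assms unfolding compact_induction_def mem_Collect_eq by simp_all

section \<open>Linear structure of the compact induction\<close>

lemma (in vector_space) vector_space_fun_scale: "vector_space (fun_scale scale)"
  by unfold_locales (auto simp: fun_scale_def fun_eq_iff algebra_simps)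

lemma (in smooth_rep) action_linear:
  assumes "h \<in> H"
  shows action_zero: "\<rho> h 0 = 0"
    and action_add: "\<rho> h (v + w) = \<rho> h v + \<rho> h w"
    and action_scale: "\<rho> h (scl c v) = scl c (\<rho> h v)"
proof -
  interpret Vector_Spaces.linear scl scl "\<rho> h"
    by (rule linear_action[OF assms])
  show "\<rho> h 0 = 0" "\<rho> h (v + w) = \<rho> h v + \<rho> h w" "\<rho> h (scl c v) = scl c (\<rho> h v)"
    by (rule zero add scale)+
qed

lemma (in smooth_rep) restrict_fun_scale:
  "restrict_plus t (fun_scale scl c f) = fun_scale scl c (restrict_plus t f)"
  by (auto simp: restrict_plus_def fun_scale_def)

lemma (in smooth_rep) compact_induction_subspace:
  "module.subspace (fun_scale scl) (compact_induction G H \<rho>)"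
proof -
  interpret FW: vector_space "fun_scale scl"
    by (rule vector_space_fun_scale)
  show ?thesis
  proof (rule FW.subspaceI)
    show "0 \<in> compact_induction G H \<rho>"
    proof (rule compact_inductionI)
      show "\<exists>U. openin (top_of_set G) U \<and> g \<in> U \<and> (\<forall>h\<in>U. 0 h = 0 g)" if "g \<in> G" for g
        using that by (intro exI[of _ G]) auto
    qed (auto simp: action_zero)
  next
    fix c f assume f: "f \<in> compact_induction G H \<rho>"
    obtain C where C: "compact C" "C \<subseteq> G" "\<forall>g. g \<notin> C \<longrightarrow> f g = 0"
      using compact_inductionD(4)[OF f] by blast
    show "fun_scale scl c f \<in> compact_induction G H \<rho>"
    proof (rule compact_inductionI[OF _ _ _ C(1,2)])
      show "\<exists>U. openin (top_of_set G) U \<and> g \<in> U \<and> (\<forall>h\<in>U. fun_scale scl c f h = fun_scale scl c f g)"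
        if "g \<in> G" for g
        using compact_inductionD(3)[OF f that] by (auto simp: fun_scale_def)
    qed (simp_all add: fun_scale_def compact_inductionD(1,2)[OF f] action_scale C(3))
  next
    fix f f' assume f: "f \<in> compact_induction G H \<rho>" and f': "f' \<in> compact_induction G H \<rho>"
    obtain C where C: "compact C" "C \<subseteq> G" "\<forall>g. g \<notin> C \<longrightarrow> f g = 0"
      using compact_inductionD(4)[OF f] by blast
    obtain C' where C': "compact C'" "C' \<subseteq> G" "\<forall>g. g \<notin> C' \<longrightarrow> f' g = 0"
      using compact_inductionD(4)[OF f'] by blast
    show "f + f' \<in> compact_induction G H \<rho>"
    proof (rule compact_inductionI)
      show "\<exists>U. openin (top_of_set G) U \<and> g \<in> U \<and> (\<forall>h\<in>U. (f + f') h = (f + f') g)"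
        if g: "g \<in> G" for g
      proof -
        obtain U where U: "openin (top_of_set G) U" "g \<in> U" "\<forall>h\<in>U. f h = f g"
          using compact_inductionD(3)[OF f g] by blast
        obtain U' where U': "openin (top_of_set G) U'" "g \<in> U'" "\<forall>h\<in>U'. f' h = f' g"
          using compact_inductionD(3)[OF f' g] by blast
        show ?thesis
        proof (intro exI[of _ "U \<inter> U'"] conjI ballI openin_Int U(1) U'(1) IntI U(2) U'(2))
          fix h assume "h \<in> U \<inter> U'"
          then have "f h = f g" "f' h = f' g"
            using U(3) U'(3) by blast+
          then show "(f + f') h = (f + f') g"
            by simp
        qed
      qed
      show "compact (C \<union> C')" "C \<union> C' \<subseteq> G"
        using C C' by (auto intro: compact_Un)
    qed (simp_all add: compact_inductionD(1,2)[OF f] compact_inductionD(1,2)[OF f'] action_add C(3) C'(3))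
  qed
qed

text \<open>A basis of \<open>W\<close> is an independent subset of a finitely spanned space, hence
  finite.\<close>

lemma (in vector_space) subspace_of_finite_span:
  assumes "finite T" "subspace W" "W \<subseteq> span T"
  shows "finite_dimensional_subspace scale W"
proof -
  obtain B where B: "B \<subseteq> W" "independent B" "W \<subseteq> span B"
    by (rule basis_exists)
  have "finite B"
    using independent_span_bound[OF assms(1) B(2)] B(1) assms(3) by blast
  moreover have "W = span B"
    using B assms(2) span_minimal by blast
  ultimately show ?thesis
    unfolding finite_dimensional_subspace_def by blast
qed

section \<open>Splitting kernel elements along the two sides\<close>

context unramified_quadratic
begin

text \<open>The side is locally constant and invariant under \<open>K\<close> on the left, and the
  old compact set still contains the support.\<close>

lemma restrict_plus_compact_induction:
  assumes w: "uniformizer \<omega>" and rep: "smooth_rep scl (max_compact bar \<omega> v) \<sigma>"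
    and f: "f \<in> compact_induction (U21 bar) (max_compact bar \<omega> v) \<sigma>"
  shows "restrict_plus (vertex_scale \<omega> v) f
    \<in> compact_induction (U21 bar) (max_compact bar \<omega> v) \<sigma>"
proof -
  interpret smooth_rep scl "max_compact bar \<omega> v" \<sigma>
    by (rule rep)
  let ?t = "vertex_scale \<omega> v" and ?G = "U21 bar" and ?K = "max_compact bar \<omega> v"
  obtain C where C: "compact C" "C \<subseteq> ?G" "\<forall>g. g \<notin> C \<longrightarrow> f g = 0"
    using compact_inductionD(4)[OF f] by blast
  show ?thesis
  proof (rule compact_inductionI[OF _ _ _ C(1,2)])
    show "\<exists>U. openin (top_of_set ?G) U \<and> g \<in> U \<and>
      (\<forall>h\<in>U. restrict_plus ?t f h = restrict_plus ?t f g)" if g: "g \<in> ?G" for g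
    proof -
      obtain U where U: "openin (top_of_set ?G) U" "g \<in> U" "\<forall>h\<in>U. f h = f g"
        using compact_inductionD(3)[OF f g] by blast
      obtain U' where U': "openin (top_of_set ?G) U'" "g \<in> U'"
          "\<And>h. h \<in> U' \<Longrightarrow> plus_side ?t h \<longleftrightarrow> plus_side ?t g"
        using plus_side_locally_constant[OF g vertex_scale_ge_1[OF w]] by blast
      show ?thesis
      proof (intro exI[of _ "U \<inter> U'"] conjI ballI openin_Int U(1) U'(1) IntI U(2) U'(2))
        fix h assume "h \<in> U \<inter> U'"
        then have "f h = f g" "plus_side ?t h \<longleftrightarrow> plus_side ?t g"
          using U(3) U'(3) by blast+
        then show "restrict_plus ?t f h = restrict_plus ?t f g"
          by (simp add: restrict_plus_def)
      qed
    qed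
  qed (simp_all add: restrict_plus_def compact_inductionD(1,2)[OF f] C(3)
      plus_side_max_compact_mult[OF w] action_zero)
qed

text \<open>Functions supported in a fixed set form a subspace, so only the generating summands need
  checking. The exponents in \<open>R_minus\<close> start at -1, hence are all negative.\<close>

lemma I_plus_I_minus_supported:
  assumes w: "uniformizer \<omega>" and rep: "smooth_rep scl (max_compact bar \<omega> v) \<sigma>"
  defines "A \<equiv> compact_induction (U21 bar) (max_compact bar \<omega> v) \<sigma>"
  shows "I_plus bar \<omega> v scl \<sigma> \<subseteq> {f \<in> A. \<forall>g. f g \<noteq> 0 \<longrightarrow> plus_side (vertex_scale \<omega> v) g}"
    and "I_minus bar \<omega> v scl \<sigma> \<subseteq> {f \<in> A. \<forall>g. f g \<noteq> 0 \<longrightarrow> \<not> plus_side (vertex_scale \<omega> v) g}"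
proof -
  interpret smooth_rep scl "max_compact bar \<omega> v" \<sigma>
    by (rule rep)
  interpret FW: vector_space "fun_scale scl"
    by (rule vector_space_fun_scale)
  have A: "FW.subspace A"
    unfolding A_def by (rule compact_induction_subspace)
  have sub: "FW.subspace {f \<in> A. \<forall>g. f g \<noteq> 0 \<longrightarrow> P g}" for P
  proof (rule FW.subspaceI)
    show "0 \<in> {f \<in> A. \<forall>g. f g \<noteq> 0 \<longrightarrow> P g}"
      using FW.subspace_0[OF A] by simp
    fix f assume f: "f \<in> {f \<in> A. \<forall>g. f g \<noteq> 0 \<longrightarrow> P g}"
    show "fun_scale scl c f \<in> {f \<in> A. \<forall>g. f g \<noteq> 0 \<longrightarrow> P g}" for c
      using f FW.subspace_scale[OF A, of f c] by (auto simp: fun_scale_def)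
    fix f' assume f': "f' \<in> {f \<in> A. \<forall>g. f g \<noteq> 0 \<longrightarrow> P g}"
    have "P g" if "(f + f') g \<noteq> 0" for g
      using f f' that by (cases "f g = 0") auto
    then show "f + f' \<in> {f \<in> A. \<forall>g. f g \<noteq> 0 \<longrightarrow> P g}"
      using f f' FW.subspace_add[OF A] by blast
  qed
  show "I_plus bar \<omega> v scl \<sigma> \<subseteq> {f \<in> A. \<forall>g. f g \<noteq> 0 \<longrightarrow> plus_side (vertex_scale \<omega> v) g}"
    unfolding I_plus_def
    by (intro FW.span_minimal sub)
      (auto simp: R_plus_def supported_part_def A_def plus_side_double_coset[OF w])
  show "I_minus bar \<omega> v scl \<sigma> \<subseteq> {f \<in> A. \<forall>g. f g \<noteq> 0 \<longrightarrow> \<not> plus_side (vertex_scale \<omega> v) g}"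
    unfolding I_minus_def
    by (intro FW.span_minimal sub)
      (auto simp: R_minus_def supported_part_def A_def plus_side_double_coset[OF w])
qed

lemma finite_dimensional_intersection:
  fixes \<omega> :: 'e and v :: vertex
    and scaleW :: "'k::field \<Rightarrow> 'w::ab_group_add \<Rightarrow> 'w"
    and \<iota> :: "('e mat3 \<Rightarrow> 'w) \<Rightarrow> 'v::ab_group_add"
  defines "G \<equiv> U21 bar" and "K \<equiv> max_compact bar \<omega> v"
  assumes w: "uniformizer \<omega>"
    and quot: "compact_induction_quotient scaleW K \<sigma> scaleV G \<pi> \<iota>"
    and fg: "finitely_generated_over_group (fun_scale scaleW) G right_translation
      (induction_kernel G K \<sigma> \<iota>)"
  shows "finite_dimensional_subspace scaleV
    (\<iota> ` I_plus bar \<omega> v scaleW \<sigma> \<inter> \<iota> ` I_minus bar \<omega> v scaleW \<sigma>)"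
proof -
  interpret compact_induction_quotient scaleW K \<sigma> scaleV G \<pi> \<iota>
    by (rule quot)
  interpret FW: vector_space "fun_scale scaleW"
    by (rule weight.vector_space_fun_scale)
  define A where "A = compact_induction G K \<sigma>"
  define t where "t = vertex_scale \<omega> v"
  define N where "N = induction_kernel G K \<sigma> \<iota>"
  note rep = weight.smooth_rep_axioms[unfolded K_def]
  have t: "1 \<le> t"
    unfolding t_def by (rule vertex_scale_ge_1[OF w])
  have A: "FW.subspace A"
    unfolding A_def by (rule weight.compact_induction_subspace)
  have add: "\<iota> (f + f') = \<iota> f + \<iota> f'" if "f \<in> A" "f' \<in> A" for f f'
    using that map_add by (simp add: A_def)
  have scale: "\<iota> (fun_scale scaleW c f) = scaleV c (\<iota> f)" if "f \<in> A" for c f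
    using that map_scale by (simp add: A_def)
  have zero: "\<iota> 0 = 0"
    using add[of 0 0] FW.subspace_0[OF A] by simp
  have diff: "\<iota> (f - f') = \<iota> f - \<iota> f'" if "f \<in> A" "f' \<in> A" for f f'
    using add[of "f - f'" f'] FW.subspace_diff[OF A] that by simp
  have restrict: "restrict_plus t f \<in> A" if "f \<in> A" for f
    using restrict_plus_compact_induction[OF w rep] that by (simp add: A_def G_def K_def t_def)
  \<comment> \<open>The map \<open>\<iota>\<close> is assumed linear only on \<open>A\<close>, so
    the images are treated by hand.\<close>
  have image: "target.subspace (\<iota> ` W)" if "FW.subspace W" "W \<subseteq> A" for W
  proof (rule target.subspaceI)
    show "0 \<in> \<iota> ` W"
      using zero FW.subspace_0[OF that(1)] by (metis image_eqI)
    show "x + y \<in> \<iota> ` W" if "x \<in> \<iota> ` W" "y \<in> \<iota> ` W" for x y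
      using that add FW.subspace_add[OF \<open>FW.subspace W\<close>] \<open>W \<subseteq> A\<close>
      by (auto simp: subset_iff) (metis image_eqI)
    show "scaleV c x \<in> \<iota> ` W" if "x \<in> \<iota> ` W" for c x
      using that scale FW.subspace_scale[OF \<open>FW.subspace W\<close>] \<open>W \<subseteq> A\<close>
      by (auto simp: subset_iff) (metis image_eqI)
  qed
  obtain S where S: "finite S" "S \<subseteq> N"
    "N = FW.span {right_translation h s | h s. h \<in> G \<and> s \<in> S}"
    using fg unfolding finitely_generated_over_group_def N_def by blast
  have N: "f \<in> A" "\<iota> f = 0" if "f \<in> N" for f
    using that by (auto simp: N_def induction_kernel_def A_def)
  define Q where "Q = (\<Union>s\<in>S. {right_translation h s | h. h \<in> G \<and> straddles t (right_translation h s)})"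
  define T where "T = (\<lambda>r. \<iota> (restrict_plus t r)) ` Q"
  have "finite Q"
    unfolding Q_def
  proof (rule finite_UN_I[OF S(1)])
    fix s assume "s \<in> S"
    then have "s \<in> compact_induction (U21 bar) K \<sigma>"
      using S(2) N(1) unfolding A_def G_def by blast
    then show "finite {right_translation h s | h. h \<in> G \<and> straddles t (right_translation h s)}"
      unfolding G_def using finite_straddling_translates t by blast
  qed
  then have T: "finite T"
    by (simp add: T_def)
  have gen: "\<iota> (restrict_plus t r) \<in> target.span T" if r: "r = right_translation h s" "h \<in> G" "s \<in> S" for r h s
  proof -
    have "r \<in> N"
      unfolding S(3) using r by (intro FW.span_base) auto
    consider "straddles t r" | "\<And>g. r g \<noteq> 0 \<Longrightarrow> plus_side t g" | "\<And>g. r g \<noteq> 0 \<Longrightarrow> \<not> plus_side t g"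
      unfolding straddles_def by blast
    then show ?thesis
    proof cases
      case 1
      then have "\<iota> (restrict_plus t r) \<in> T"
        using r by (auto simp: T_def Q_def)
      then show ?thesis
        by (rule target.span_base)
    next
      case 2
      then have "restrict_plus t r = r"
        by (auto simp: restrict_plus_def fun_eq_iff)
      then show ?thesis
        using N[OF \<open>r \<in> N\<close>] by (simp add: target.span_zero)
    next
      case 3
      then have "restrict_plus t r = 0"
        by (auto simp: restrict_plus_def fun_eq_iff)
      then show ?thesis
        by (simp add: zero target.span_zero)
    qed
  qed
  \<comment> \<open>Restriction and \<open>\<iota>\<close> are linear on \<open>A\<close>, so the
    conclusion for the generators extends to all of \<open>N\<close>.\<close>
  let ?Z = "{f \<in> A. \<iota> (restrict_plus t f) \<in> target.span T}"
  have "FW.subspace ?Z"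
  proof (rule FW.subspaceI)
    have "restrict_plus t (0 :: 'e mat3 \<Rightarrow> 'w) = 0"
      by (auto simp: restrict_plus_def)
    then show "0 \<in> ?Z"
      using FW.subspace_0[OF A] by (simp add: zero target.span_zero)
    show "f + f' \<in> ?Z" if "f \<in> ?Z" "f' \<in> ?Z" for f f'
      using that FW.subspace_add[OF A]
      by (simp add: restrict_plus_add add restrict target.span_add)
    show "fun_scale scaleW c f \<in> ?Z" if "f \<in> ?Z" for c f
      using that FW.subspace_scale[OF A]
      by (simp add: weight.restrict_fun_scale scale restrict target.span_scale)
  qed
  moreover have "{right_translation h s | h s. h \<in> G \<and> s \<in> S} \<subseteq> ?Z"
  proof -
    have "right_translation h s \<in> A" if "h \<in> G" "s \<in> S" for h s
    proof (rule N(1))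
      show "right_translation h s \<in> N"
        unfolding S(3) by (rule FW.span_base) (use that in blast)
    qed
    then show ?thesis
      using gen by blast
  qed
  ultimately have NZ: "N \<subseteq> ?Z"
    unfolding S(3) by (intro FW.span_minimal)
  note supp = I_plus_I_minus_supported[OF w rep, folded G_def, folded K_def, folded A_def t_def]
  have "\<iota> ` I_plus bar \<omega> v scaleW \<sigma> \<inter> \<iota> ` I_minus bar \<omega> v scaleW \<sigma> \<subseteq> target.span T"
  proof
    fix x assume "x \<in> \<iota> ` I_plus bar \<omega> v scaleW \<sigma> \<inter> \<iota> ` I_minus bar \<omega> v scaleW \<sigma>"
    then obtain f f' where f: "f \<in> I_plus bar \<omega> v scaleW \<sigma>" "x = \<iota> f"
      and f': "f' \<in> I_minus bar \<omega> v scaleW \<sigma>" "x = \<iota> f'"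
      by auto
    have fA: "f \<in> A" "f' \<in> A"
      using f f' supp by auto
    have "f - f' \<in> N"
      using fA diff FW.subspace_diff[OF A] f(2) f'(2)
      by (simp add: N_def induction_kernel_def A_def[symmetric])
    moreover have "restrict_plus t (f - f') = f"
      using supp f(1) f'(1) by (fastforce simp: restrict_plus_def)
    ultimately show "x \<in> target.span T"
      using NZ f(2) by auto
  qed
  \<comment> \<open>Containment in a finite span is not yet enough: the intersection must itself be
    a span, so it has to be a subspace.\<close>
  moreover have "target.subspace (\<iota> ` I_plus bar \<omega> v scaleW \<sigma> \<inter> \<iota> ` I_minus bar \<omega> v scaleW \<sigma>)"
    using supp by (intro target.subspace_inter image) (auto simp: I_plus_def I_minus_def)
  ultimately show ?thesis
    using target.subspace_of_finite_span[OF T] by blast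
qed

end

theorem proposition1p3:
  fixes emb :: "'f::nonarch_local_field \<Rightarrow> 'e::nonarch_local_field"
    and bar :: "'e \<Rightarrow> 'e"
    and \<omega> :: 'e
    and v :: vertex
    and scaleW :: "'p::prime_card Fp_bar \<Rightarrow> 'w::ab_group_add \<Rightarrow> 'w"
    and \<sigma> :: "'e mat3 \<Rightarrow> 'w \<Rightarrow> 'w"
    and scaleV :: "'p Fp_bar \<Rightarrow> 'v::ab_group_add \<Rightarrow> 'v"
    and \<pi> :: "'e mat3 \<Rightarrow> 'v \<Rightarrow> 'v"
    and \<iota> :: "('e mat3 \<Rightarrow> 'w) \<Rightarrow> 'v"
  defines "G \<equiv> U21 bar"
    and "K \<equiv> max_compact bar \<omega> v"
  assumes "unramified_quadratic emb bar"
    and "(of_nat CARD('p) :: 'f) \<in> max_ideal" and "odd CARD('p)"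
    and "uniformizer \<omega>" and "\<omega> \<in> range emb"
    and "compact_induction_quotient scaleW K \<sigma> scaleV G \<pi> \<iota>"
    and "finitely_generated_over_group (fun_scale scaleW) G right_translation
           (induction_kernel G K \<sigma> \<iota>)"
  shows "finite_dimensional_subspace scaleV
           (\<iota> ` I_plus bar \<omega> v scaleW \<sigma> \<inter> \<iota> ` I_minus bar \<omega> v scaleW \<sigma>)"
proof -
  interpret unramified_quadratic emb bar
    by (rule assms(3))
  show ?thesis
    using assms(6,8,9) unfolding G_def K_def by (rule finite_dimensional_intersection)
qed

end
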